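(* Let $\xi,\eta,\xi',\eta'\in\mathbb F_q^*$ and let $f\in\Phi$ have degree $2$. Let $\boldsymbol\lambda=(1)_{t-\xi}$, $\boldsymbol\mu=(1)_{t-\eta}$. For $\boldsymbol\nu\in\mathcal{P}(\Phi)$ with $\|\boldsymbol\nu\|=2$, we have $a^{\boldsymbol\nu}_{\boldsymbol\lambda\boldsymbol\mu}=0$ whenever the determinant of an element of modified type $\boldsymbol\nu$ differs from $\xi\eta$. Otherwise (i.e. when this determinant equals $\xi\eta$): $a^{(1)_{t-\xi'}\cup(1)_{t-\eta'}}_{\boldsymbol\lambda\boldsymbol\mu}$ equals $q-1$ if $\xi'\ne\eta'$ and $\{\xi',\eta'\}\ne\{\xi,\eta\}$; equals $2q-1$ if $\xi'\ne\eta'$ and $\{\xi',\eta'\}=\{\xi,\eta\}$; equals $q^2+q$ if $\xi'=\eta'=\xi=\eta$; and equals $0$ otherwise. Also $a^{(2)_{t-\xi'}}_{\boldsymbol\lambda\boldsymbol\mu}$ equals $q$ if $\xi'\notin\{\xi,\eta\}$ and $2q$ if $\xi'\in\{\xi,\eta\}$; and $a^{(1)_f}_{\boldsymbol\lambda\boldsymbol\mu}=q+1$.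
   Context: $q$ is a prime power, $G_n=GL_n(\mathbb F_q)$ with $G_m\subset G_n$ via $g\mapsto\mathrm{diag}(g,I_{n-m})$ (determinants of elements are thus independent of $n$). $\Phi$ is the set of monic irreducible polynomials in $\mathbb F_q[t]$ other than $t$, $d(f)$ its degree; $\mathcal{P}(\Phi)$ is the set of finitely supported maps $\boldsymbol\lambda$ from $\Phi$ to partitions, $\|\boldsymbol\lambda\|=\sum_f d(f)|\boldsymbol\lambda(f)|$, $\boldsymbol\lambda^e=\boldsymbol\lambda(t-1)$, $\ell$ = number of nonzero parts. For a partition $\rho$ and $f\in\Phi$, $(\rho)_f$ takes value $\rho$ at $f$ and $\emptyset$ elsewhere; $(\boldsymbol\lambda\cup\boldsymbol\mu)(f)=\boldsymbol\lambda(f)\cup\boldsymbol\mu(f)$ (union of parts). The type of $g\in G_n$ is the $\boldsymbol\lambda$ with $\mathbb F_q^n\cong\bigoplus_{f,i}\mathbb F_q[t]/(f^{\boldsymbol\lambda_i(f)})$ ($t$ acting by $g$); its modified type agrees with $\boldsymbol\lambda$ off $t-1$ and at $t-1$ is $(\boldsymbol\lambda^e_1-1,\dots,\boldsymbol\lambda^e_r-1)$ (zero parts discarded), $r=\ell(\boldsymbol\lambda^e)$. $K_{\boldsymbol\mu}(n)$ is the sum in $\mathbb Z[G_n]$ of all elements of modified type $\boldsymbol\mu$; the nonzero ones form a basis of the center of $\mathbb Z[G_n]$ with $K_{\boldsymbol\lambda}(n)K_{\boldsymbol\mu}(n)=\sum_{\boldsymbol\nu}a^{\boldsymbol\nu}_{\boldsymbol\lambda\boldsymbol\mu}(n)K_{\boldsymbol\nu}(n)$.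 For $\|\boldsymbol\nu\|=\|\boldsymbol\lambda\|+\|\boldsymbol\mu\|$, $a^{\boldsymbol\nu}_{\boldsymbol\lambda\boldsymbol\mu}(n)$ is independent of $n\ge\|\boldsymbol\nu\|+\ell(\boldsymbol\nu^e)$ and is denoted $a^{\boldsymbol\nu}_{\boldsymbol\lambda\boldsymbol\mu}$. *)

theory Defs
  imports "Jordan_Normal_Form.Determinant" "HOL-Computational_Algebra.Polynomial"
    "HOL-Library.Multiset"
begin

definition GL :: "nat \<Rightarrow> 'a :: field mat set" where
  "GL n = {g. g \<in> carrier_mat n n \<and> det g \<noteq> 0}"

definition Phi :: "'a :: field poly set" where
  "Phi = {f. lead_coeff f = 1 \<and> irreducible f \<and> f \<noteq> [:0, 1:]}"

definition is_partition :: "nat multiset \<Rightarrow> bool" where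
  "is_partition p \<longleftrightarrow> 0 \<notin># p"

definition PPhi :: "('a :: field poly \<Rightarrow> nat multiset) set" where
  "PPhi = {lam. finite {f. lam f \<noteq> {#}} \<and> (\<forall>f. lam f \<noteq> {#} \<longrightarrow> f \<in> Phi)
              \<and> (\<forall>f. is_partition (lam f))}"

definition supp :: "('a poly \<Rightarrow> nat multiset) \<Rightarrow> 'a poly set" where
  "supp lam = {f. lam f \<noteq> {#}}"

definition pnorm :: "('a :: field poly \<Rightarrow> nat multiset) \<Rightarrow> nat" where
  "pnorm lam = (\<Sum>f\<in>supp lam. degree f * sum_mset (lam f))"

definition epart :: "('a :: field poly \<Rightarrow> nat multiset) \<Rightarrow> nat multiset" where
  "epart lam = lam [:-1, 1:]"

definition single :: "nat multiset \<Rightarrow> 'a poly \<Rightarrow> ('a poly \<Rightarrow> nat multiset)" where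
  "single rho f = (\<lambda>g. if g = f then rho else {#})"

definition punion :: "('a poly \<Rightarrow> nat multiset) \<Rightarrow> ('a poly \<Rightarrow> nat multiset) \<Rightarrow> ('a poly \<Rightarrow> nat multiset)" where
  "punion lam mu = (\<lambda>f. lam f + mu f)"

(* companion matrix of a monic polynomial p of degree m: the matrix of
   multiplication by t on F_q[t]/(p) in the basis 1, t, ..., t^(m-1) *)
definition companion :: "'a :: comm_ring_1 poly \<Rightarrow> 'a mat" where
  "companion p = mat (degree p) (degree p)
     (\<lambda>(i, j). if j = degree p - 1 then - coeff p i
               else if i = j + 1 then 1 else 0)"

definition parts_pairs :: "('a poly \<Rightarrow> nat multiset) \<Rightarrow> ('a poly \<times> nat) multiset" where
  "parts_pairs lam = (\<Sum>f\<in>supp lam. image_mset (\<lambda>k. (f, k)) (lam f))"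

(* g has type lambda: F_q^n = (+)_{f,i} F_q[t]/(f^{lambda_i(f)}) as F_q[t]-modules
   (t acting by g), i.e. g is similar to the block diagonal sum of the companion
   matrices of the f^{lambda_i(f)} *)
definition has_type :: "'a :: field mat \<Rightarrow> ('a poly \<Rightarrow> nat multiset) \<Rightarrow> bool" where
  "has_type g lam \<longleftrightarrow> lam \<in> PPhi \<and>
     (\<exists>bs. mset bs = parts_pairs lam \<and>
        similar_mat g (diag_block_mat (map (\<lambda>(f, k). companion (f ^ k)) bs)))"

definition modify :: "('a :: field poly \<Rightarrow> nat multiset) \<Rightarrow> ('a poly \<Rightarrow> nat multiset)" where
  "modify lam = (\<lambda>f. if f = [:-1, 1:]
       then filter_mset (\<lambda>k. k \<noteq> 0) (image_mset (\<lambda>k. k - 1) (lam f))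
       else lam f)"

definition has_mtype :: "'a :: field mat \<Rightarrow> ('a poly \<Rightarrow> nat multiset) \<Rightarrow> bool" where
  "has_mtype g mu \<longleftrightarrow> (\<exists>lam. has_type g lam \<and> modify lam = mu)"

(* coefficient of the group element z in the product K_lambda(n) K_mu(n) in Z[G_n];
   for z of modified type nu this is a^nu_{lambda mu}(n) *)
definition coeff_prod :: "('a :: field poly \<Rightarrow> nat multiset) \<Rightarrow> ('a poly \<Rightarrow> nat multiset)
    \<Rightarrow> nat \<Rightarrow> 'a mat \<Rightarrow> nat" where
  "coeff_prod lam mu n z = card {(x, y). x \<in> GL n \<and> y \<in> GL n \<and> has_mtype x lam
       \<and> has_mtype y mu \<and> x * y = z}"

end

(* An element x has modified type (1)_{t - xi} iff x - 1 has rank one and det x = xi. For z of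
   modified type nu with ||nu|| = 2 write z = 1 + P Q with P, Q of rank two; T = 1 + Q P is then the
   block sum of the companion matrices of nu. Factorisations z = x y into elements of the two given
   types correspond to 2 x 2 idempotents M of rank one with tr (M T) = xi, through x = 1 + P M Q.
   Counting them is trivial for scalar T; otherwise T may be taken to be a companion matrix, and
   they are the points of an affine conic, counted by projection from one of its points. *)

theory Submission
  imports Defs "HOL-Computational_Algebra.Polynomial_Factorial"
begin

section \<open>Matrices as perturbations of the identity\<close>

text \<open>Since \<open>z P = P T\<close> with \<open>P\<close> injective, \<open>T\<close> is the
  action of \<open>z\<close> on the image of \<open>z - 1\<close>. Passing to that image turns a
  summand F[t]/((t-1)^k) into F[t]/((t-1)^(k-1)) and leaves the other primary summands alone, so the
  type of \<open>T\<close> is the modified type of \<open>z\<close>: a matrix of size 2, whatever n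
  is. In a factorisation the ranks 1 + 1 = 2 add up, and this forces the two summands of
  \<open>P Q\<close> to come from complementary idempotents \<open>M\<close> and
  \<open>1 - M\<close>. The determinant of the second factor is then determined by that of
  \<open>z\<close>, so a single linear condition on \<open>M\<close> remains. With p the
  characteristic polynomial of a non-scalar \<open>T\<close>, the conic degenerates exactly when
  p(xi) = 0. It then contains a whole line of slope xi, the source of the extra q in the values 2q -
  1 and 2q. Each root of p costs one slope, which separates two distinct roots, a double root and an
  irreducible p. A scalar \<open>T\<close> is similar to no companion matrix; there the linear
  condition is either vacuous or unsatisfiable.\<close>

lemma mult_mat_assoc_dim:
  "dim_col A = dim_row B \<Longrightarrow> dim_col B = dim_row C \<Longrightarrow> (A * B) * C = A * (B * (C :: 'a :: semiring_0 mat))"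
  by (rule assoc_mult_mat[of _ "dim_row A" "dim_col A" _ "dim_col B" _ "dim_col C"]) auto

lemma mult_mat_cancel_dim:
  assumes "A * B = 1\<^sub>m k" "dim_col A = dim_row B" "k = dim_row X"
  shows "A * (B * X) = (X :: 'a :: semiring_1 mat)"
proof -
  have "dim_col B = k" using assms(1) by (metis index_mult_mat(3) index_one_mat(3))
  then have "A * (B * X) = (A * B) * X" using assms(2,3) by (intro mult_mat_assoc_dim[symmetric]) auto
  also have "\<dots> = X" unfolding assms(1) by (rule left_mult_one_mat'[OF assms(3)[symmetric]])
  finally show ?thesis .
qed

lemma mult_add_mat_dim:
  "dim_row B = dim_row C \<Longrightarrow> dim_col B = dim_col C \<Longrightarrow> dim_col A = dim_row C
   \<Longrightarrow> A * (B + C) = A * B + A * (C :: 'a :: semiring_0 mat)"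
  by (rule mult_add_distrib_mat[of _ "dim_row A" "dim_col A" _ "dim_col C"]) auto

lemma add_mult_mat_dim:
  "dim_row A = dim_row B \<Longrightarrow> dim_col A = dim_col B \<Longrightarrow> dim_col B = dim_row C
   \<Longrightarrow> (A + B) * C = A * C + B * (C :: 'a :: semiring_0 mat)"
  by (rule add_mult_distrib_mat[of _ "dim_row A" "dim_col A" _ _ "dim_col C"]) auto

text \<open>The side conditions are equations between dimensions, so that chains of rectangular
  products can be rewritten without naming their sizes.\<close>

lemmas mat_dim_simps = mult_mat_assoc_dim mult_add_mat_dim add_mult_mat_dim

text \<open>The block matrix with rows (1, -P) and (Q, 1) is a product of block triangular matrices
  in two ways, according to which off-diagonal block is eliminated; each way yields one
  side.\<close>

lemma det_one_add_mult_commute: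
  fixes P :: "'a :: idom mat"
  assumes P: "P \<in> carrier_mat n k" and Q: "Q \<in> carrier_mat k n"
  shows "det (1\<^sub>m n + P * Q) = det (1\<^sub>m k + Q * P)"
proof -
  let ?F = "four_block_mat (1\<^sub>m n) (- P) Q (1\<^sub>m k)"
  note d[simp] = carrier_matD[OF P] carrier_matD[OF Q]
  have c: "1\<^sub>m n + P * Q \<in> carrier_mat n n" "1\<^sub>m k + Q * P \<in> carrier_mat k k" "- P \<in> carrier_mat n k"
    using P Q by auto
  have z: "1\<^sub>m n + P * Q + - P * Q = 1\<^sub>m n" "- P * 1\<^sub>m k = - P" "Q * - P + (1\<^sub>m k + Q * P) = 1\<^sub>m k"
    using P Q by (auto intro!: eq_matI)
  have "?F = four_block_mat (1\<^sub>m n) (0\<^sub>m n k) Q (1\<^sub>m k)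
        * four_block_mat (1\<^sub>m n) (- P) (0\<^sub>m k n) (1\<^sub>m k + Q * P)"
    by (subst mult_four_block_mat[OF one_carrier_mat zero_carrier_mat Q one_carrier_mat
          one_carrier_mat c(3) zero_carrier_mat c(2)])
      (use P Q c z in simp)
  moreover have "?F = four_block_mat (1\<^sub>m n) (- P) (0\<^sub>m k n) (1\<^sub>m k)
        * four_block_mat (1\<^sub>m n + P * Q) (0\<^sub>m n k) Q (1\<^sub>m k)"
    by (subst mult_four_block_mat[OF one_carrier_mat c(3) zero_carrier_mat one_carrier_mat
          c(1) zero_carrier_mat Q one_carrier_mat])
      (use P Q c z in simp)
  ultimately have "det (four_block_mat (1\<^sub>m n) (0\<^sub>m n k) Q (1\<^sub>m k)
        * four_block_mat (1\<^sub>m n) (- P) (0\<^sub>m k n) (1\<^sub>m k + Q * P)) =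
      det (four_block_mat (1\<^sub>m n) (- P) (0\<^sub>m k n) (1\<^sub>m k)
        * four_block_mat (1\<^sub>m n + P * Q) (0\<^sub>m n k) Q (1\<^sub>m k))" by simp
  then show ?thesis using P Q c
    by (simp add: det_mult[where n = "n + k"]
      det_four_block_mat_upper_right_zero[where n = n and m = k]
      det_four_block_mat_lower_left_zero[where n = n and m = k])
qed

text \<open>The one-sided inverses \<open>L\<close> and \<open>R\<close> express that
  \<open>P\<close> has full column rank and \<open>Q\<close> full row rank. So \<open>P * Q\<close>
  is a rank factorisation of \<open>z - 1\<close>, \<open>k\<close> is the rank, and
  \<open>T\<close> is \<open>z\<close> on the image of \<open>z - 1\<close>, written in the basis of
  columns of \<open>P\<close>.\<close>

definition core_form :: "nat \<Rightarrow> nat \<Rightarrow> 'a :: field mat \<Rightarrow> 'a mat \<Rightarrow> bool" where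
  "core_form n k z T \<longleftrightarrow> (\<exists>P Q L R. P \<in> carrier_mat n k \<and> Q \<in> carrier_mat k n \<and>
     L \<in> carrier_mat k n \<and> R \<in> carrier_mat n k \<and> L * P = 1\<^sub>m k \<and> Q * R = 1\<^sub>m k \<and>
     z = 1\<^sub>m n + P * Q \<and> T = 1\<^sub>m k + Q * P)"

lemma core_formI:
  assumes "P \<in> carrier_mat n k" "Q \<in> carrier_mat k n" "L \<in> carrier_mat k n" "R \<in> carrier_mat n k"
    "L * P = 1\<^sub>m k" "Q * R = 1\<^sub>m k" "z = 1\<^sub>m n + P * Q" "T = 1\<^sub>m k + Q * P"
  shows "core_form n k z T"
  using assms unfolding core_form_def by blast

lemma core_formE:
  assumes "core_form n k z T"
  obtains P Q L R where
    "P \<in> carrier_mat n k" "Q \<in> carrier_mat k n" "L \<in> carrier_mat k n" "R \<in> carrier_mat n k"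
    "L * P = 1\<^sub>m k" "Q * R = 1\<^sub>m k" "z = 1\<^sub>m n + P * Q" "T = 1\<^sub>m k + Q * P"
  using assms unfolding core_form_def by blast

lemma core_form_carrier:
  assumes "core_form n k z T"
  shows "z \<in> carrier_mat n n" "T \<in> carrier_mat k k"
  using assms by (auto elim!: core_formE)

lemma core_form_det: "core_form n k z T \<Longrightarrow> det z = det T"
  by (erule core_formE) (metis det_one_add_mult_commute)

lemma core_form_similar:
  assumes "similar_mat z w" "core_form n k w T"
  shows "core_form n k z T"
proof -
  from similar_matD[OF assms(1)] obtain m S S' where
    S0: "{z, w, S, S'} \<subseteq> carrier_mat m m" "S * S' = 1\<^sub>m m" "S' * S = 1\<^sub>m m" "z = S * w * S'" by blast
  have "w \<in> carrier_mat n n" by (rule core_form_carrier[OF assms(2)])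
  with S0 have mn: "m = n" by auto
  from assms(2) obtain P Q L R where
    c: "P \<in> carrier_mat n k" "Q \<in> carrier_mat k n" "L \<in> carrier_mat k n" "R \<in> carrier_mat n k"
    and e: "L * P = 1\<^sub>m k" "Q * R = 1\<^sub>m k" "w = 1\<^sub>m n + P * Q" "T = 1\<^sub>m k + Q * P"
    by (elim core_formE)
  have S: "S \<in> carrier_mat n n" "S' \<in> carrier_mat n n" and SS: "S * S' = 1\<^sub>m n" "S' * S = 1\<^sub>m n"
    using S0 mn by auto
  note [simp] = carrier_matD[OF c(1)] carrier_matD[OF c(2)] carrier_matD[OF c(3)]
    carrier_matD[OF c(4)] carrier_matD[OF S(1)] carrier_matD[OF S(2)]
  show ?thesis
    by (rule core_formI[of "S * P" n k "Q * S'" "L * S'" "S * R"])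
      (use c S in \<open>auto simp: mat_dim_simps e SS mult_mat_cancel_dim[OF SS(2)] S0(4)\<close>)
qed

text \<open>Inserting \<open>S * S'\<close> between \<open>P\<close> and \<open>Q\<close> keeps
  \<open>P * Q\<close> and conjugates \<open>Q * P\<close>, so the core matters only up to
  similarity.\<close>

lemma core_form_similar_core:
  assumes "similar_mat T T'" "core_form n k z T"
  shows "core_form n k z T'"
proof -
  from similar_matD[OF assms(1)] obtain m S S' where
    S0: "{T, T', S, S'} \<subseteq> carrier_mat m m" "S * S' = 1\<^sub>m m" "S' * S = 1\<^sub>m m" "T = S * T' * S'" by blast
  have "T \<in> carrier_mat k k" by (rule core_form_carrier[OF assms(2)])
  with S0 have mn: "m = k" by auto
  from assms(2) obtain P Q L R where
    c: "P \<in> carrier_mat n k" "Q \<in> carrier_mat k n" "L \<in> carrier_mat k n" "R \<in> carrier_mat n k"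
    and e: "L * P = 1\<^sub>m k" "Q * R = 1\<^sub>m k" "z = 1\<^sub>m n + P * Q" "T = 1\<^sub>m k + Q * P"
    by (elim core_formE)
  have S: "S \<in> carrier_mat k k" "S' \<in> carrier_mat k k" "T' \<in> carrier_mat k k"
    and SS: "S * S' = 1\<^sub>m k" "S' * S = 1\<^sub>m k"
    using S0 mn by auto
  note [simp] = carrier_matD[OF c(1)] carrier_matD[OF c(2)] carrier_matD[OF c(3)]
    carrier_matD[OF c(4)] carrier_matD[OF S(1)] carrier_matD[OF S(2)] carrier_matD[OF S(3)]
  have "T' = S' * T * S"
    unfolding S0(4) using S by (simp add: mat_dim_simps SS mult_mat_cancel_dim[OF SS(2)])
  also have "\<dots> = 1\<^sub>m k + S' * Q * (P * S)"
    unfolding e(4) using c S by (simp add: mat_dim_simps SS)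
  finally have T': "T' = 1\<^sub>m k + S' * Q * (P * S)" .
  show ?thesis
    by (rule core_formI[of "P * S" n k "S' * Q" "S' * L" "R * S"])
      (use c S T' in \<open>auto simp: mat_dim_simps e(1-3) SS mult_mat_cancel_dim[OF SS(1)] mult_mat_cancel_dim[OF e(1)]
        mult_mat_cancel_dim[OF e(2)]\<close>)
qed

lemma core_form_four_block:
  assumes "core_form n1 k1 z1 T1" "core_form n2 k2 z2 T2"
  shows "core_form (n1 + n2) (k1 + k2) (four_block_mat z1 (0\<^sub>m n1 n2) (0\<^sub>m n2 n1) z2)
     (four_block_mat T1 (0\<^sub>m k1 k2) (0\<^sub>m k2 k1) T2)"
proof -
  from assms(1) obtain P Q L R where
    c: "P \<in> carrier_mat n1 k1" "Q \<in> carrier_mat k1 n1" "L \<in> carrier_mat k1 n1" "R \<in> carrier_mat n1 k1"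
    and e: "L * P = 1\<^sub>m k1" "Q * R = 1\<^sub>m k1" "z1 = 1\<^sub>m n1 + P * Q" "T1 = 1\<^sub>m k1 + Q * P"
    by (elim core_formE)
  from assms(2) obtain P' Q' L' R' where
    c': "P' \<in> carrier_mat n2 k2" "Q' \<in> carrier_mat k2 n2" "L' \<in> carrier_mat k2 n2" "R' \<in> carrier_mat n2 k2"
    and e': "L' * P' = 1\<^sub>m k2" "Q' * R' = 1\<^sub>m k2" "z2 = 1\<^sub>m n2 + P' * Q'" "T2 = 1\<^sub>m k2 + Q' * P'"
    by (elim core_formE)
  let ?F = "\<lambda>A B. four_block_mat A (0\<^sub>m (dim_row A) (dim_col B)) (0\<^sub>m (dim_row B) (dim_col A)) B"
  have m: "?F A B * ?F C D = ?F (A * C) (B * D)"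
    if h: "A \<in> carrier_mat a1 b1" "B \<in> carrier_mat a2 b2"
      "C \<in> carrier_mat b1 c1" "D \<in> carrier_mat b2 c2" for A B C D :: "'a mat" and a1 b1 c1 a2 b2 c2
  proof -
    have z: "A * 0\<^sub>m b1 c2 = 0\<^sub>m a1 c2" "0\<^sub>m a1 b2 * D = 0\<^sub>m a1 c2" "0\<^sub>m a1 b2 * 0\<^sub>m b2 c1 = (0\<^sub>m a1 c1 :: 'a mat)"
      "0\<^sub>m a2 b1 * C = 0\<^sub>m a2 c1" "B * 0\<^sub>m b2 c1 = 0\<^sub>m a2 c1" "0\<^sub>m a2 b1 * 0\<^sub>m b1 c2 = (0\<^sub>m a2 c2 :: 'a mat)"
      "A * C \<in> carrier_mat a1 c1" "B * D \<in> carrier_mat a2 c2"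
      using h by auto
    note d = h[THEN carrier_matD(1)] h[THEN carrier_matD(2)]
    show ?thesis
      unfolding d index_mult_mat(2,3)
      unfolding mult_four_block_mat[OF h(1) zero_carrier_mat zero_carrier_mat h(2,3)
          zero_carrier_mat zero_carrier_mat h(4)] z(1-6)
      using z(7,8) by simp
  qed
  have one: "1\<^sub>m (a + b) + ?F A B = four_block_mat (1\<^sub>m a + A) (0\<^sub>m a b) (0\<^sub>m b a) (1\<^sub>m b + B)"
    if "A \<in> carrier_mat a a" "B \<in> carrier_mat b b" for A B :: "'a mat" and a b
    using that by (intro eq_matI) auto
  note [simp] = carrier_matD[OF c(1)] carrier_matD[OF c(2)] carrier_matD[OF c(3)] carrier_matD[OF c(4)]
   carrier_matD[OF c'(1)] carrier_matD[OF c'(2)] carrier_matD[OF c'(3)] carrier_matD[OF c'(4)]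
  show ?thesis
  proof (rule core_formI[of "?F P P'" _ _ "?F Q Q'" "?F L L'" "?F R R'"])
    show "?F L L' * ?F P P' = 1\<^sub>m (k1 + k2)" by (subst m[OF c(3) c'(3) c(1) c'(1)]) (simp_all add: e e')
    show "?F Q Q' * ?F R R' = 1\<^sub>m (k1 + k2)" by (subst m[OF c(2) c'(2) c(4) c'(4)]) (simp_all add: e e')
    show "four_block_mat z1 (0\<^sub>m n1 n2) (0\<^sub>m n2 n1) z2 = 1\<^sub>m (n1 + n2) + ?F P P' * ?F Q Q'"
      by (subst m[OF c(1) c'(1) c(2) c'(2)]) (use one[of "P * Q" n1 "P' * Q'" n2] c c' in \<open>simp add: e e'\<close>)
    show "four_block_mat T1 (0\<^sub>m k1 k2) (0\<^sub>m k2 k1) T2 = 1\<^sub>m (k1 + k2) + ?F Q Q' * ?F P P'"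
      by (subst m[OF c(2) c'(2) c(1) c'(1)]) (use one[of "Q * P" k1 "Q' * P'" k2] c c' in \<open>simp add: e e'\<close>)
  qed (use c c' in auto)
qed

section \<open>Companion matrices\<close>

lemma companion_carrier [simp]: "companion p \<in> carrier_mat (degree p) (degree p)"
  by (simp add: companion_def)

lemma invertible_matE:
  fixes A :: "'a :: field mat"
  assumes "A \<in> carrier_mat n n" "det A \<noteq> 0"
  obtains B where "B \<in> carrier_mat n n" "A * B = 1\<^sub>m n" "B * A = 1\<^sub>m n"
  using det_non_zero_imp_unit[OF assms, of "()"] that
  unfolding Units_def ring_mat_simps by auto

text \<open>Multiplication by t - 1 is injective on F[t]/(g) when g(1) is nonzero. Row i of the
  fixed point equation reads v_i = v_(i-1) - g_i v_(m-1); the partial sums telescope, and the last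
  of them is g(1) v_(m-1) = 0.\<close>

lemma companion_fixes_no_vector:
  fixes g :: "'a :: field poly"
  assumes "lead_coeff g = 1" "poly g 1 \<noteq> 0" and v: "v \<in> carrier_vec (degree g)"
    and inv: "companion g *\<^sub>v v = v"
  shows "v = 0\<^sub>v (degree g)"
proof (cases "degree g = 0")
  case True
  then show ?thesis using v by auto
next
  case False
  define m where "m = degree g"
  have m: "0 < m" using False by (simp add: m_def)
  have row: "v $ i = (if i = 0 then 0 else v $ (i - 1)) - coeff g i * v $ (m - 1)" if "i < m" for i
  proof -
    have "v $ i = (\<Sum>j\<in>{0..<m}. companion g $$ (i, j) * v $ j)"
      using arg_cong[OF inv, of "\<lambda>w. w $ i"] that v
      by (simp add: companion_def m_def scalar_prod_def)
    also have "\<dots> = (\<Sum>j\<in>{0..<m}. (if j = m - 1 then - coeff g i * v $ j else 0)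
        + (if j = i - 1 then if i = 0 then 0 else v $ j else 0))"
      using that by (intro sum.cong) (auto simp: companion_def m_def)
    also have "\<dots> = - coeff g i * v $ (m - 1) + (if i = 0 then 0 else v $ (i - 1))"
      using that m by (auto simp: sum.distrib)
    finally show ?thesis by simp
  qed
  have sums: "v $ i + (\<Sum>l\<le>i. coeff g l) * v $ (m - 1) = 0" if "i < m" for i
    using that
  proof (induction i)
    case 0
    show ?case using row[OF 0] by simp
  next
    case (Suc i)
    then show ?case using row[OF Suc.prems] by (simp add: ring_distribs)
  qed
  have "poly g 1 = (\<Sum>l\<le>m - 1. coeff g l) + 1"
    using m assms(1) by (cases m) (simp_all add: poly_altdef flip: m_def)
  with sums[of "m - 1"] m have "poly g 1 * v $ (m - 1) = 0" by (simp add: algebra_simps)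
  with assms(2) have "v $ (m - 1) = 0" by simp
  with sums v have "v $ i = 0" if "i < m" for i using that by fastforce
  with v show ?thesis by (intro eq_vecI) (auto simp: m_def)
qed

text \<open>Here t - 1 is invertible, so the image of z - 1 is the whole space and the core is the
  matrix itself, with \<open>P\<close> = z - 1 and \<open>Q\<close> = 1.\<close>

lemma core_form_companion:
  fixes g :: "'a :: field poly"
  assumes "lead_coeff g = 1" "poly g 1 \<noteq> 0"
  shows "core_form (degree g) (degree g) (companion g) (companion g)"
proof -
  let ?m = "degree g"
  define B where "B = companion g + (- 1\<^sub>m ?m)"
  have B: "B \<in> carrier_mat ?m ?m" by (simp add: B_def)
  have eq: "companion g = 1\<^sub>m ?m + B"
    by (rule eq_matI) (auto simp: B_def companion_def)
  have "det B \<noteq> 0"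
  proof
    assume "det B = 0"
    then obtain v where v: "v \<in> carrier_vec ?m" "v \<noteq> 0\<^sub>v ?m" "B *\<^sub>v v = 0\<^sub>v ?m"
      using det_0_iff_vec_prod_zero[OF B] by auto
    have "companion g *\<^sub>v v = v"
      unfolding eq using v B add_mult_distrib_mat_vec[of "1\<^sub>m ?m" ?m ?m B v] by simp
    from companion_fixes_no_vector[OF assms v(1) this] v(2) show False by simp
  qed
  from invertible_matE[OF B this] obtain B' where
    B': "B' \<in> carrier_mat ?m ?m" "B' * B = 1\<^sub>m ?m" by metis
  show ?thesis
    by (rule core_formI[of B _ _ "1\<^sub>m ?m" B' "1\<^sub>m ?m"]) (use B B' eq in auto)
qed

text \<open>Multiplication by \<open>t - 1\<close> embeds \<open>F[t]/(g)\<close> into \<open>F[t]/((t - 1) g)\<close>, and composing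
  the reduction \<open>F[t]/((t - 1) g) \<rightarrow> F[t]/(g)\<close> with it is multiplication by \<open>t - 1\<close>;
  \<open>P\<close> and \<open>Q\<close> are the matrices of these two maps.\<close>

lemma core_form_companion_unipotent:
  fixes g :: "'a :: field poly"
  assumes monic: "lead_coeff g = 1"
  shows "core_form (Suc (degree g)) (degree g) (companion ([:- 1, 1:] * g)) (companion g)"
proof -
  define m where "m = degree g"
  define P :: "'a mat" where
    "P = mat (Suc m) m (\<lambda>(i, j). if i = j then - 1 else if i = Suc j then 1 else 0)"
  define Q where
    "Q = mat m (Suc m) (\<lambda>(i, j). if j = m then - coeff g i else if i = j then 1 else 0)"
  \<comment> \<open>Right multiplication by \<open>P\<close> takes differences of neighbouring
    entries in a row, so a row that jumps from 0 to 1 after position \<open>i\<close> becomes the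
    \<open>i\<close>-th unit row.\<close>
  define L :: "'a mat" where "L = mat m (Suc m) (\<lambda>(i, j). if i < j then 1 else 0)"
  define R :: "'a mat" where "R = mat (Suc m) m (\<lambda>(i, j). if i = j then 1 else 0)"
  have g0: "g \<noteq> 0" using monic by auto
  have lc: "coeff g m = 1" using monic by (simp add: m_def)
  have deg: "degree ([:- 1, 1:] * g) = Suc m"
    using g0 by (subst degree_mult_eq) (auto simp: m_def)
  have coeff: "coeff ([:- 1, 1:] * g) i = (if i = 0 then 0 else coeff g (i - 1)) - coeff g i" for i
    by (cases i) (auto simp: coeff_pCons)
  have c: "P \<in> carrier_mat (Suc m) m" "Q \<in> carrier_mat m (Suc m)"
    "L \<in> carrier_mat m (Suc m)" "R \<in> carrier_mat (Suc m) m"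
    by (auto simp: P_def Q_def L_def R_def)
  have XP: "(X * P) $$ (i, j) = X $$ (i, Suc j) - X $$ (i, j)"
    if "X \<in> carrier_mat m (Suc m)" "i < m" "j < m" for X i j
  proof -
    have "(X * P) $$ (i, j) = (\<Sum>l\<in>{0..<Suc m}. X $$ (i, l) * P $$ (l, j))"
      using that c by (simp add: scalar_prod_def)
    also have "\<dots> = (\<Sum>l\<in>{0..<Suc m}. (if l = Suc j then X $$ (i, l) else 0)
        + (if l = j then - X $$ (i, l) else 0))"
      using that by (intro sum.cong) (auto simp: P_def)
    also have "\<dots> = X $$ (i, Suc j) - X $$ (i, j)"
      using that by (subst sum.distrib, subst (1 2) sum.delta) auto
    finally show ?thesis .
  qed
  have PQ: "(P * Q) $$ (i, j) = (if i = 0 then 0 else Q $$ (i - 1, j)) - (if i < m then Q $$ (i, j) else 0)"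
    if "i < Suc m" "j < Suc m" for i j
  proof -
    have "(P * Q) $$ (i, j) = (\<Sum>l\<in>{0..<m}. P $$ (i, l) * Q $$ (l, j))"
      using that c by (simp add: scalar_prod_def)
    also have "\<dots> = (\<Sum>l\<in>{0..<m}. (if l = i - 1 then if i = 0 then 0 else Q $$ (l, j) else 0)
        + (if l = i then - Q $$ (l, j) else 0))"
      using that by (intro sum.cong) (auto simp: P_def)
    also have "\<dots> = (if i = 0 then 0 else Q $$ (i - 1, j)) - (if i < m then Q $$ (i, j) else 0)"
      using that by (subst sum.distrib, subst (1 2) sum.delta) auto
    finally show ?thesis .
  qed
  have QR: "Q * R = 1\<^sub>m m"
  proof (rule eq_matI)
    fix i j assume "i < dim_row (1\<^sub>m m)" "j < dim_col (1\<^sub>m m)"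
    then have ij: "i < m" "j < m" by auto
    have "(Q * R) $$ (i, j) = (\<Sum>l\<in>{0..<Suc m}. Q $$ (i, l) * R $$ (l, j))"
      using ij c by (simp add: scalar_prod_def)
    also have "\<dots> = (\<Sum>l\<in>{0..<Suc m}. if l = j then Q $$ (i, l) else 0)"
      using ij by (intro sum.cong) (auto simp: R_def)
    also have "\<dots> = Q $$ (i, j)" using ij by (subst sum.delta) auto
    finally show "(Q * R) $$ (i, j) = 1\<^sub>m m $$ (i, j)" using ij by (simp add: Q_def)
  qed (use c in auto)
  have "core_form (Suc m) m (companion ([:- 1, 1:] * g)) (companion g)"
  proof (rule core_formI[OF c])
    show "L * P = 1\<^sub>m m"
      by (rule eq_matI) (use c in \<open>auto simp: XP simp del: index_mult_mat(1)\<close>, auto simp: L_def)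
    show "Q * R = 1\<^sub>m m" by (rule QR)
    show "companion ([:- 1, 1:] * g) = 1\<^sub>m (Suc m) + P * Q"
    proof (rule eq_matI)
      fix i j assume "i < dim_row (1\<^sub>m (Suc m) + P * Q)" "j < dim_col (1\<^sub>m (Suc m) + P * Q)"
      then have ij: "i < Suc m" "j < Suc m" using c by auto
      have *: "(1\<^sub>m (Suc m) + P * Q) $$ (i, j) = (if i = j then 1 else 0) + (P * Q) $$ (i, j)"
        using ij c by simp
      have "companion ([:- 1, 1:] * g) $$ (i, j) =
          (if j = m then coeff g i - (if i = 0 then 0 else coeff g (i - 1)) else if i = Suc j then 1 else 0)"
        unfolding companion_def deg coeff using ij by simp
      \<comment> \<open>Monicity of \<open>g\<close> enters in the corner \<open>i = j = m\<close>:
        the 1 of the identity matrix is the leading coefficient of \<open>g\<close>.\<close>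
      also have "\<dots> = (1\<^sub>m (Suc m) + P * Q) $$ (i, j)"
        unfolding * PQ[OF ij] using ij lc by (auto simp: Q_def)
      finally show "companion ([:- 1, 1:] * g) $$ (i, j) = (1\<^sub>m (Suc m) + P * Q) $$ (i, j)" .
    qed (use c in \<open>auto simp: companion_def deg simp del: mult_pCons_left\<close>)
    show "companion g = 1\<^sub>m m + Q * P"
    proof (rule eq_matI)
      fix i j assume "i < dim_row (1\<^sub>m m + Q * P)" "j < dim_col (1\<^sub>m m + Q * P)"
      then have ij: "i < m" "j < m" using c by auto
      have *: "(1\<^sub>m m + Q * P) $$ (i, j) = (if i = j then 1 else 0) + (Q * P) $$ (i, j)"
        using ij c by simp
      show "companion g $$ (i, j) = (1\<^sub>m m + Q * P) $$ (i, j)"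
        unfolding * XP[OF c(2) ij] using ij by (auto simp: Q_def companion_def m_def)
    qed (use c in \<open>auto simp: companion_def m_def\<close>)
  qed
  then show ?thesis by (simp add: m_def)
qed

section \<open>Modified types\<close>

lemma Phi_root:
  assumes "f \<in> Phi" "poly f a = 0"
  shows "f = [:- a, 1:]"
proof -
  have f: "lead_coeff f = 1" "irreducible f" using assms by (auto simp: Phi_def)
  from assms(2) obtain h where h: "f = [:- a, 1:] * h"
    by (auto simp: poly_eq_0_iff_dvd)
  have "\<not> [:- a, 1:] dvd 1" by (simp add: is_unit_iff_degree)
  with irreducibleD[OF f(2) h] have "h dvd 1" by blast
  then obtain c where "h = [:c:]" by (auto simp: is_unit_poly_iff)
  with f(1) h have "h = [:c:]" "c = 1" by (auto split: if_splits)
  with h show ?thesis by simp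
qed

lemma linear_in_Phi: "a \<noteq> 0 \<Longrightarrow> [:- a, 1:] \<in> Phi"
  by (simp add: Phi_def irreducible_linear_field_poly)

text \<open>The effect of \<open>modify\<close> on one block. Parts that drop to 0 are kept at this
  stage: f^0 = 1 has the empty companion matrix, so discarding them later leaves the block sum
  unchanged.\<close>

definition shift_pair :: "'a :: field poly \<times> nat \<Rightarrow> 'a poly \<times> nat" where
  "shift_pair = (\<lambda>(f, k). (f, if f = [:- 1, 1:] then k - 1 else k))"

lemma parts_pairs_eq_sum:
  assumes "finite A" "supp lam \<subseteq> A"
  shows "parts_pairs lam = (\<Sum>f\<in>A. image_mset (Pair f) (lam f))"
  unfolding parts_pairs_def
  by (rule sum.mono_neutral_left) (use assms in \<open>auto simp: supp_def\<close>)

lemma in_parts_pairs: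
  assumes "lam \<in> PPhi" "(f, k) \<in># parts_pairs lam"
  shows "f \<in> Phi" "k \<noteq> 0"
proof -
  have "finite (supp lam)" using assms by (simp add: PPhi_def supp_def)
  then have "k \<in># lam f" using assms(2) by (auto simp: parts_pairs_def set_mset_sum)
  moreover from this have "lam f \<noteq> {#}" by auto
  ultimately show "f \<in> Phi" "k \<noteq> 0"
    using assms(1) by (auto simp: PPhi_def is_partition_def intro: gr0I)
qed

text \<open>Turns \<open>modify\<close> into an operation on individual blocks, so that it can be
  compared with cores one block at a time.\<close>

lemma parts_pairs_modify:
  assumes "lam \<in> PPhi"
  shows "parts_pairs (modify lam) =
    filter_mset (\<lambda>(f, k). k \<noteq> 0) (image_mset shift_pair (parts_pairs lam))"
proof -
  have fin: "finite (supp lam)" using assms by (simp add: PPhi_def supp_def)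
  have sub: "supp (modify lam) \<subseteq> supp lam" by (auto simp: supp_def modify_def split: if_splits)
  have dist: "filter_mset P (image_mset h (\<Sum>f\<in>A. F f)) =
      (\<Sum>f\<in>A. filter_mset P (image_mset h (F f)))"
    for P h A and F :: "'a poly \<Rightarrow> ('a poly \<times> nat) multiset"
    by (induction A rule: infinite_finite_induct) auto
  have "filter_mset (\<lambda>(f, k). k \<noteq> 0) (image_mset shift_pair (image_mset (Pair f) (lam f)))
      = image_mset (Pair f) (modify lam f)" for f
  proof (cases "f = [:- 1, 1:]")
    case True
    then show ?thesis
      by (simp add: modify_def shift_pair_def filter_mset_image_mset image_mset.compositionality o_def)
  next
    case False
    have "0 \<notin># lam f" using assms by (auto simp: PPhi_def is_partition_def)
    then have pos: "filter_mset (\<lambda>k. k \<noteq> 0) (lam f) = lam f"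
      by (subst filter_mset_eq_conv) (auto intro: gr0I)
    have "filter_mset (\<lambda>(f, k). k \<noteq> 0) (image_mset shift_pair (image_mset (Pair f) (lam f)))
        = image_mset (Pair f) (filter_mset (\<lambda>k. k \<noteq> 0) (lam f))"
      using False by (simp add: shift_pair_def filter_mset_image_mset image_mset.compositionality o_def)
    also have "\<dots> = image_mset (Pair f) (modify lam f)" using False pos by (simp add: modify_def)
    finally show ?thesis .
  qed
  then show ?thesis
    unfolding parts_pairs_eq_sum[OF fin sub] parts_pairs_eq_sum[OF fin order_refl] dist by simp
qed

section \<open>Block sums of companion matrices and their cores\<close>

definition companion_blocks :: "('a :: field poly \<times> nat) list \<Rightarrow> 'a mat" where
  "companion_blocks bs = diag_block_mat (map (\<lambda>(f, k). companion (f ^ k)) bs)"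

lemma companion_blocks_Nil [simp]: "companion_blocks [] = 0\<^sub>m 0 0"
  by (simp add: companion_blocks_def)

lemma companion_blocks_Cons:
  "companion_blocks ((f, k) # bs) =
    four_block_mat (companion (f ^ k)) (0\<^sub>m (degree (f ^ k)) (dim_col (companion_blocks bs)))
      (0\<^sub>m (dim_row (companion_blocks bs)) (degree (f ^ k))) (companion_blocks bs)"
  by (simp add: companion_blocks_def Let_def companion_def)

text \<open>A power of t - 1 loses one factor. Any other prime in \<open>Phi\<close> does not vanish
  at 1, since a root at 1 would make it equal to t - 1, and so keeps its full block.\<close>

lemma core_form_prime_power:
  assumes "f \<in> Phi" "k \<noteq> 0" "shift_pair (f, k) = (f, j)"
  shows "core_form (degree (f ^ k)) (degree (f ^ j)) (companion (f ^ k)) (companion (f ^ j))"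
proof (cases "f = [:- 1, 1:]")
  case True
  with assms obtain i where k: "k = Suc i" and "j = i" by (cases k) (auto simp: shift_pair_def)
  have "lead_coeff (f ^ i) = 1" using True by (simp add: lead_coeff_power)
  from core_form_companion_unipotent[OF this] show ?thesis
    using True \<open>j = i\<close> degree_mult_eq[of "[:- 1, 1:]" "[:- 1, 1 :: 'a:] ^ i"]
    by (simp add: k degree_power_eq del: mult_pCons_left)
next
  case False
  with assms have "j = k" by (auto simp: shift_pair_def)
  moreover have "poly (f ^ k) 1 \<noteq> 0" using Phi_root[OF assms(1), of 1] False by auto
  moreover have "lead_coeff (f ^ k) = 1" using assms(1) by (simp add: Phi_def lead_coeff_power)
  ultimately show ?thesis using core_form_companion by blast
qed

lemma core_form_companion_blocks:
  assumes "\<And>f k. (f, k) \<in> set bs \<Longrightarrow> f \<in> Phi \<and> k \<noteq> 0"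
  shows "\<exists>n m. core_form n m (companion_blocks bs)
    (companion_blocks (filter (\<lambda>(f, k). k \<noteq> 0) (map shift_pair bs)))"
  using assms
proof (induction bs)
  case Nil
  have "core_form 0 0 (0\<^sub>m 0 0) (0\<^sub>m 0 0 :: 'a mat)"
    by (rule core_formI[of "0\<^sub>m 0 0" _ _ "0\<^sub>m 0 0" "0\<^sub>m 0 0" "0\<^sub>m 0 0"]) auto
  then show ?case by auto
next
  case (Cons b bs)
  obtain f k where b: "b = (f, k)" by fastforce
  obtain j where j: "shift_pair (f, k) = (f, j)" by (auto simp: shift_pair_def)
  let ?bs' = "filter (\<lambda>(f, k). k \<noteq> 0) (map shift_pair bs)"
  obtain n m where IH: "core_form n m (companion_blocks bs) (companion_blocks ?bs')"
    using Cons by auto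
  have 1: "core_form (degree (f ^ k)) (degree (f ^ j)) (companion (f ^ k)) (companion (f ^ j))"
    using Cons.prems[of f k] j by (intro core_form_prime_power) (auto simp: b)
  note c = core_form_carrier[OF IH]
  have "companion_blocks (filter (\<lambda>(f, k). k \<noteq> 0) (map shift_pair (b # bs))) =
    four_block_mat (companion (f ^ j)) (0\<^sub>m (degree (f ^ j)) m) (0\<^sub>m m (degree (f ^ j))) (companion_blocks ?bs')"
  proof (cases "j = 0")
    case True
    then show ?thesis using j c by (intro eq_matI) (auto simp: b companion_def)
  next
    case False
    then show ?thesis using j c by (auto simp: b companion_blocks_Cons)
  qed
  moreover have "companion_blocks (b # bs) =
    four_block_mat (companion (f ^ k)) (0\<^sub>m (degree (f ^ k)) n) (0\<^sub>m n (degree (f ^ k))) (companion_blocks bs)"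
    using c by (auto simp: b companion_blocks_Cons)
  ultimately show ?case using core_form_four_block[OF 1 IH] by auto
qed

text \<open>The bridge from types to matrices: the core of \<open>z\<close> is assembled from the
  blocks of its modified type. The order of \<open>bs\<close> and the size \<open>m\<close> stay
  open; each application recovers them from the multiset and from dimensions.\<close>

lemma has_mtype_core_form:
  assumes "z \<in> carrier_mat n n" "has_mtype z nu"
  obtains bs m where "mset bs = parts_pairs nu" "core_form n m z (companion_blocks bs)"
proof -
  from assms(2) obtain lam bs where lam: "lam \<in> PPhi" and nu: "modify lam = nu"
    and bs: "mset bs = parts_pairs lam" and sim: "similar_mat z (companion_blocks bs)"
    by (auto simp: has_mtype_def has_type_def companion_blocks_def)
  have "f \<in> Phi \<and> k \<noteq> 0" if "(f, k) \<in> set bs" for f k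
    using in_parts_pairs[OF lam, of f k] that by (simp flip: bs)
  then obtain n' m where *: "core_form n' m (companion_blocks bs)
     (companion_blocks (filter (\<lambda>(f, k). k \<noteq> 0) (map shift_pair bs)))"
    using core_form_companion_blocks by blast
  note cf = core_form_similar[OF sim *]
  then have "n' = n" using core_form_carrier[OF cf] assms(1) by auto
  moreover have "mset (filter (\<lambda>(f, k). k \<noteq> 0) (map shift_pair bs)) = parts_pairs nu"
    by (simp add: bs parts_pairs_modify[OF lam] flip: nu)
  ultimately show ?thesis using cf that by blast
qed

section \<open>Rank one perturbations up to similarity\<close>

definition rank_one_update :: "nat \<Rightarrow> (nat \<Rightarrow> 'a :: field) \<Rightarrow> (nat \<Rightarrow> 'a) \<Rightarrow> 'a mat" where
  "rank_one_update n u v = mat n n (\<lambda>(i, j). (if i = j then 1 else 0) + u i * v j)"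

text \<open>With S the matrix of \<open>s\<close>, the hypotheses say S u' = u and v S = v', so both
  (1 + u v) S and S (1 + u' v') equal S + u v'. Invertibility of S is asked for as injectivity,
  which spares an explicit inverse.\<close>

lemma similar_rank_one_update:
  fixes s :: "nat \<Rightarrow> nat \<Rightarrow> 'a :: field"
  assumes inj: "\<And>w. (\<And>i. i < n \<Longrightarrow> (\<Sum>j\<in>{0..<n}. s i j * w j) = 0) \<Longrightarrow> \<forall>j<n. w j = 0"
    and u: "\<And>i. i < n \<Longrightarrow> (\<Sum>j\<in>{0..<n}. s i j * u' j) = u i"
    and v: "\<And>j. j < n \<Longrightarrow> (\<Sum>i\<in>{0..<n}. v i * s i j) = v' j"
  shows "similar_mat (rank_one_update n u v) (rank_one_update n u' v')"
proof -
  define S where "S = mat n n (\<lambda>(i, j). s i j)"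
  have S: "S \<in> carrier_mat n n" by (simp add: S_def)
  have "det S \<noteq> 0"
  proof
    assume "det S = 0"
    then obtain w where w: "w \<in> carrier_vec n" "w \<noteq> 0\<^sub>v n" "S *\<^sub>v w = 0\<^sub>v n"
      using det_0_iff_vec_prod_zero[OF S] by auto
    have "(\<Sum>j\<in>{0..<n}. s i j * w $ j) = 0" if "i < n" for i
      using arg_cong[OF w(3), of "\<lambda>y. y $ i"] that w(1)
      by (simp add: S_def scalar_prod_def)
    from inj[OF this] have "w = 0\<^sub>v n" using w(1) by (intro eq_vecI) auto
    with w(2) show False by simp
  qed
  from invertible_matE[OF S this] obtain S' where
    S': "S' \<in> carrier_mat n n" "S * S' = 1\<^sub>m n" "S' * S = 1\<^sub>m n" .
  let ?A = "rank_one_update n u v" and ?B = "rank_one_update n u' v'"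
  have AB: "?A \<in> carrier_mat n n" "?B \<in> carrier_mat n n" by (auto simp: rank_one_update_def)
  have "?A * S = S * ?B"
  proof (rule eq_matI)
    fix i j assume "i < dim_row (S * ?B)" "j < dim_col (S * ?B)"
    then have ij: "i < n" "j < n" using S AB by auto
    have "(?A * S) $$ (i, j) = (\<Sum>k\<in>{0..<n}. (if k = i then s k j else 0) + u i * (v k * s k j))"
      using ij by (simp add: rank_one_update_def S_def scalar_prod_def algebra_simps)
        (intro sum.cong, auto simp: algebra_simps)
    also have "\<dots> = s i j + u i * v' j"
      using ij v by (simp add: sum.distrib flip: sum_distrib_left)
    also have "\<dots> = s i j + (\<Sum>k\<in>{0..<n}. s i k * u' k) * v' j" using u ij by simp
    also have "\<dots> = (\<Sum>k\<in>{0..<n}. (if k = j then s i k else 0) + s i k * u' k * v' j)"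
      using ij by (simp add: sum.distrib flip: sum_distrib_right)
    also have "\<dots> = (S * ?B) $$ (i, j)"
      using ij by (simp add: rank_one_update_def S_def scalar_prod_def algebra_simps)
        (intro sum.cong, auto simp: algebra_simps)
    finally show "(?A * S) $$ (i, j) = (S * ?B) $$ (i, j)" .
  qed (use S AB in auto)
  then have "?A * S * S' = S * ?B * S'" by simp
  then have "?A = S * ?B * S'" using S S' AB by (simp add: assoc_mult_mat[of _ n n _ n _ n])
  with S S' AB show ?thesis by (intro similar_matI[of _ _ S S' n]) auto
qed

text \<open>Used to move nonzero entries of \<open>u\<close> and \<open>v\<close> to the positions 0
  and 1 that the normal forms expect.\<close>

lemma rank_one_update_permute:
  assumes "p permutes {0..<n}"
  shows "similar_mat (rank_one_update n u v) (rank_one_update n (u \<circ> p) (v \<circ> p))"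
proof (rule similar_rank_one_update[where s = "\<lambda>i j. if i = p j then 1 else 0"])
  have inj: "p i = p j \<longleftrightarrow> i = j" for i j using permutes_inj[OF assms] by (auto dest: injD)
  have p_less: "p j < n" if "j < n" for j using permutes_in_image[OF assms, of j] that by simp
  have row: "(\<Sum>j\<in>{0..<n}. (if p i = p j then 1 else 0) * w j) = w i" if "i < n" for i and w :: "nat \<Rightarrow> 'a"
  proof -
    have "(\<Sum>j\<in>{0..<n}. (if p i = p j then 1 else 0) * w j) = (\<Sum>j\<in>{0..<n}. if j = i then w j else 0)"
      by (intro sum.cong) (auto simp: inj)
    then show ?thesis using that by simp
  qed
  show "\<forall>j<n. w j = 0" if "\<And>i. i < n \<Longrightarrow> (\<Sum>j\<in>{0..<n}. (if i = p j then 1 else 0) * w j) = 0" for w :: "nat \<Rightarrow> 'a"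
    using that[OF p_less] row[of _ w] by simp
  show "(\<Sum>j\<in>{0..<n}. (if i = p j then 1 else 0) * (u \<circ> p) j) = u i" if "i < n" for i
  proof -
    obtain k where k: "i = p k" using permutes_surj[OF assms] by (metis surjD)
    then have "k < n" using that permutes_in_image[OF assms, of k] by simp
    then show ?thesis using row[of k "u \<circ> p"] k by simp
  qed
  show "(\<Sum>i\<in>{0..<n}. v i * (if i = p j then 1 else 0)) = (v \<circ> p) j" if "j < n" for j
  proof -
    have "(\<Sum>i\<in>{0..<n}. v i * (if i = p j then 1 else 0)) = (\<Sum>i\<in>{0..<n}. if i = p j then v i else 0)"
      by (intro sum.cong) auto
    then show ?thesis using p_less[OF that] by simp
  qed
qed

lemma rank_one_update_similar_diagonal:
  fixes u v :: "nat \<Rightarrow> 'a :: field"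
  assumes n: "0 < n" and v0: "v 0 \<noteq> 0" and c: "(\<Sum>i\<in>{0..<n}. v i * u i) = c" "c \<noteq> 0"
  shows "similar_mat (rank_one_update n u v)
    (rank_one_update n (\<lambda>i. if i = 0 then c else 0) (\<lambda>j. if j = 0 then 1 else 0))"
proof -
  \<comment> \<open>As \<open>v\<close> does not vanish on \<open>u\<close>, the space is the line
    of \<open>u\<close> plus the kernel of \<open>v\<close>. Column 0 is \<open>u\<close> scaled to
    \<open>v\<close>-value 1; the columns e_j - (v_j / v_0) e_0 form a basis of the kernel.\<close>
  define s where "s = (\<lambda>i j. if j = 0 then u i / c
    else (if i = j then 1 else 0) - (if i = 0 then v j / v 0 else 0))"
  have vs: "(\<Sum>i\<in>{0..<n}. v i * s i j) = (if j = 0 then 1 else 0)" if "j < n" for j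
  proof (cases "j = 0")
    case True
    then have "(\<Sum>i\<in>{0..<n}. v i * s i j) = (\<Sum>i\<in>{0..<n}. v i * u i) / c"
      by (simp add: s_def sum_divide_distrib)
    with c True show ?thesis by simp
  next
    case False
    then have "(\<Sum>i\<in>{0..<n}. v i * s i j) =
      (\<Sum>i\<in>{0..<n}. (if i = j then v i else 0) + (if i = 0 then - v i * v j / v 0 else 0))"
      by (intro sum.cong) (auto simp: s_def algebra_simps)
    with that n v0 False show ?thesis by (simp add: sum.distrib)
  qed
  show ?thesis
  proof (rule similar_rank_one_update[where s = s])
    fix w :: "nat \<Rightarrow> 'a" assume w: "\<And>i. i < n \<Longrightarrow> (\<Sum>j\<in>{0..<n}. s i j * w j) = 0"
    have "0 = (\<Sum>i\<in>{0..<n}. v i * (\<Sum>j\<in>{0..<n}. s i j * w j))" using w by simp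
    also have "\<dots> = (\<Sum>j\<in>{0..<n}. (\<Sum>i\<in>{0..<n}. v i * s i j) * w j)"
      unfolding sum_distrib_left sum_distrib_right by (subst sum.swap) (simp add: mult.assoc)
    also have "\<dots> = (\<Sum>j\<in>{0..<n}. if j = 0 then w j else 0)"
      by (intro sum.cong) (auto simp: vs)
    also have "\<dots> = w 0" using n by simp
    finally have w0: "w 0 = 0" by simp
    show "\<forall>j<n. w j = 0"
    proof (intro allI impI)
      fix i assume i: "i < n"
      show "w i = 0"
      proof (cases "i = 0")
        case False
        have "0 = (\<Sum>j\<in>{0..<n}. s i j * w j)" using w[OF i] by simp
        also have "\<dots> = (\<Sum>j\<in>{0..<n}. if j = i then w j else 0)"
          using False w0 by (intro sum.cong) (auto simp: s_def)
        finally show ?thesis using i by simp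
      qed (simp add: w0)
    qed
  next
    fix i assume "i < n"
    have "(\<Sum>j\<in>{0..<n}. s i j * (if j = 0 then c else 0)) = (\<Sum>j\<in>{0..<n}. if j = 0 then u i else 0)"
      using c(2) by (intro sum.cong) (auto simp: s_def)
    then show "(\<Sum>j\<in>{0..<n}. s i j * (if j = 0 then c else 0)) = u i" using n by simp
  qed (rule vs)
qed

lemma rank_one_update_similar_unipotent:
  fixes u v :: "nat \<Rightarrow> 'a :: field"
  assumes n: "1 < n" and v0: "v 0 \<noteq> 0" and u1: "u 1 \<noteq> 0" and c: "(\<Sum>i\<in>{0..<n}. v i * u i) = 0"
  shows "similar_mat (rank_one_update n u v)
    (rank_one_update n (\<lambda>i. if i = 0 then - 1 else if i = 1 then 1 else 0) (\<lambda>j. if j < 2 then 1 else 0))"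
proof -
  \<comment> \<open>The target is the companion matrix of (t-1)^2 padded with ones. Its row vector
    takes the value 1 on both first basis vectors, and its column vector is their difference. Since
    v r = 1 and v u = 0, the columns \<open>r\<close> and \<open>r + u\<close> reproduce this; the
    others lie in the kernel of \<open>v\<close>.\<close>
  define r where "r = (\<lambda>i::nat. if i = 0 then 1 / v 0 else 0)"
  define s where "s = (\<lambda>i j. if j = 0 then r i else if j = 1 then r i + u i
    else (if i = j then 1 else 0) - r i * v j)"
  have vr: "(\<Sum>i\<in>{0..<n}. v i * r i) = 1"
  proof -
    have "(\<Sum>i\<in>{0..<n}. v i * r i) = (\<Sum>i\<in>{0..<n}. if i = 0 then v i / v 0 else 0)"
      by (intro sum.cong) (auto simp: r_def)
    then show ?thesis using n v0 by simp
  qed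
  have vs: "(\<Sum>i\<in>{0..<n}. v i * s i j) = (if j < 2 then 1 else 0)" if "j < n" for j
  proof -
    consider "j = 0" | "j = 1" | "j \<ge> 2" by linarith
    then show ?thesis
    proof cases
      case 3
      then have "(\<Sum>i\<in>{0..<n}. v i * s i j) =
        (\<Sum>i\<in>{0..<n}. (if i = j then v i else 0) - v i * r i * v j)"
        by (intro sum.cong) (auto simp: s_def algebra_simps)
      also have "\<dots> = v j - (\<Sum>i\<in>{0..<n}. v i * r i) * v j"
        using that by (simp add: sum_subtractf flip: sum_distrib_right)
      finally show ?thesis using 3 vr by simp
    qed (use vr c in \<open>simp_all add: s_def algebra_simps sum.distrib\<close>)
  qed
  show ?thesis
  proof (rule similar_rank_one_update[where s = s])
    fix w :: "nat \<Rightarrow> 'a" assume w: "\<And>i. i < n \<Longrightarrow> (\<Sum>j\<in>{0..<n}. s i j * w j) = 0"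
    have "0 = (\<Sum>j\<in>{0..<n}. s 1 j * w j)" using w n by simp
    also have "\<dots> = (\<Sum>j\<in>{0..<n}. if j = 1 then u 1 * w j else 0)"
      by (intro sum.cong) (auto simp: s_def r_def)
    finally have w1: "w 1 = 0" using n u1 by simp
    have pos: "w i = 0" if "i \<ge> 1" "i < n" for i
    proof -
      have "0 = (\<Sum>j\<in>{0..<n}. s i j * w j)" using w that by simp
      also have "\<dots> = (\<Sum>j\<in>{0..<n}. if j = i then w j else 0)"
        using that w1 by (intro sum.cong) (auto simp: s_def r_def)
      finally show ?thesis using that by simp
    qed
    have "0 = (\<Sum>j\<in>{0..<n}. s 0 j * w j)" using w n by simp
    also have "\<dots> = (\<Sum>j\<in>{0..<n}. if j = 0 then w j / v 0 else 0)"
      using pos by (intro sum.cong) (auto simp: s_def r_def)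
    finally have "w 0 = 0" using n v0 by simp
    with pos show "\<forall>j<n. w j = 0" by (metis One_nat_def Suc_leI neq0_conv)
  next
    fix i assume "i < n"
    have "(\<Sum>j\<in>{0..<n}. s i j * (if j = 0 then - 1 else if j = 1 then 1 else 0)) =
      (\<Sum>j\<in>{0..<n}. (if j = 0 then - s i j else 0) + (if j = 1 then s i j else 0))"
      by (intro sum.cong) auto
    also have "\<dots> = s i 1 - s i 0" using n by (simp add: sum.distrib)
    finally show "(\<Sum>j\<in>{0..<n}. s i j * (if j = 0 then - 1 else if j = 1 then 1 else 0)) = u i"
      by (simp add: s_def)
  qed (rule vs)
qed

section \<open>Recognising modified type (1) at a linear polynomial\<close>

lemma companion_linear: "companion [:- a, 1:] = mat 1 1 (\<lambda>_. a)"
  by (rule eq_matI) (auto simp: companion_def)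

lemma companion_blocks_replicate: "companion_blocks (replicate m ([:- 1, 1:], 1)) = 1\<^sub>m m"
proof (induction m)
  case (Suc m)
  then show ?case
    by (simp add: companion_blocks_Cons companion_linear)
       (rule eq_matI, auto)
qed auto

lemma companion_blocks_diagonal:
  "companion_blocks (([:- a, 1:], 1) # replicate m ([:- 1, 1:], 1)) =
    rank_one_update (Suc m) (\<lambda>i. if i = 0 then a - 1 else 0) (\<lambda>j. if j = 0 then 1 else 0)"
  unfolding companion_blocks_Cons companion_blocks_replicate
  by (rule eq_matI) (auto simp: companion_linear rank_one_update_def)

lemma companion_blocks_unipotent:
  "companion_blocks (([:- 1, 1:], 2) # replicate m ([:- 1, 1 :: 'a :: field:], 1)) =
    rank_one_update (m + 2) (\<lambda>i. if i = 0 then - 1 else if i = 1 then 1 else 0)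
      (\<lambda>j. if j < 2 then 1 else 0)"
proof -
  have sq: "[:- 1, 1 :: 'a:] ^ 2 = [:1, - 2, 1:]" by (simp add: power2_eq_square)
  have deg: "degree [:1, - 2, 1 :: 'a:] = 2" by simp
  have comp: "companion [:1, - 2, 1 :: 'a:] =
      mat 2 2 (\<lambda>(i, j). if j = 1 then if i = 0 then - 1 else 2 else if i = 0 then 0 else 1)"
    by (rule eq_matI) (auto simp: companion_def less_2_cases_iff)
  show ?thesis
    unfolding companion_blocks_Cons companion_blocks_replicate sq deg comp
    by (rule eq_matI) (auto simp: rank_one_update_def less_2_cases_iff)
qed

lemma has_mtype_linearI:
  assumes xi: "xi \<noteq> 0" "xi \<noteq> 1"
    and sim: "similar_mat z (companion_blocks (([:- xi, 1:], 1) # replicate m ([:- 1, 1:], 1)))"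
  shows "has_mtype z (single {#1#} [:- xi, 1:])"
proof -
  define lam where "lam = (\<lambda>f. if f = [:- xi, 1:] then {#1#}
     else if f = [:- 1, 1:] then replicate_mset m 1 else {#} :: nat multiset)"
  have supp: "supp lam \<subseteq> {[:- xi, 1:], [:- 1, 1:]}" by (auto simp: supp_def lam_def)
  have "lam \<in> PPhi"
    using finite_subset[OF supp] linear_in_Phi[OF xi(1)] linear_in_Phi[of "1 :: 'a"]
    by (auto simp: PPhi_def is_partition_def lam_def supp_def split: if_splits)
  moreover have "mset (([:- xi, 1:], 1) # replicate m ([:- 1, 1:], 1)) = parts_pairs lam"
    using xi by (subst parts_pairs_eq_sum[OF _ supp]) (auto simp: lam_def)
  moreover have "modify lam = single {#1#} [:- xi, 1:]"
    using xi by (auto simp: modify_def single_def lam_def fun_eq_iff)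
  ultimately show ?thesis
    using sim unfolding has_mtype_def has_type_def companion_blocks_def by blast
qed

text \<open>The partition (2, 1, ..., 1) at t - 1 shrinks to (1), so transvections receive the same
  label as the diagonal case, with xi = 1.\<close>

lemma has_mtype_transvectionI:
  assumes sim: "similar_mat z (companion_blocks (([:- 1, 1:], 2) # replicate m ([:- 1, 1:], 1)))"
  shows "has_mtype z (single {#1#} [:- 1, 1:])"
proof -
  define lam :: "'a poly \<Rightarrow> nat multiset" where
    "lam = single (add_mset 2 (replicate_mset m 1)) [:- 1, 1:]"
  have supp: "supp lam \<subseteq> {[:- 1, 1:]}" by (auto simp: supp_def lam_def single_def)
  have "lam \<in> PPhi"
    using finite_subset[OF supp] linear_in_Phi[of "1 :: 'a"]
    by (auto simp: PPhi_def is_partition_def lam_def single_def supp_def split: if_splits)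
  moreover have "mset (([:- 1, 1:], 2) # replicate m ([:- 1, 1:], 1)) = parts_pairs lam"
    by (subst parts_pairs_eq_sum[OF _ supp]) (auto simp: lam_def single_def)
  moreover have "modify lam = single {#1#} [:- 1, 1:]"
    by (auto simp: modify_def single_def lam_def fun_eq_iff)
  ultimately show ?thesis
    using sim unfolding has_mtype_def has_type_def companion_blocks_def by blast
qed

declare similar_mat_trans [trans]

text \<open>Writing z = 1 + u v, the determinant gives v u = xi - 1. Thus \<open>z\<close> is
  diagonalisable with eigenvalue xi when xi differs from 1, and a transvection otherwise.\<close>

lemma core_form_one_has_mtype:
  assumes core: "core_form n 1 z T" and det: "det z = xi" "xi \<noteq> 0"
  shows "has_mtype z (single {#1#} [:- xi, 1:])"
proof -
  from core obtain P Q L R where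
    c: "P \<in> carrier_mat n 1" "Q \<in> carrier_mat 1 n" "L \<in> carrier_mat 1 n" "R \<in> carrier_mat n 1"
    and e: "L * P = 1\<^sub>m 1" "Q * R = 1\<^sub>m 1" "z = 1\<^sub>m n + P * Q" "T = 1\<^sub>m 1 + Q * P"
    by (elim core_formE)
  define u where "u = (\<lambda>i. P $$ (i, 0))"
  define v where "v = (\<lambda>j. Q $$ (0, j))"
  have z: "z = rank_one_update n u v"
    by (rule eq_matI) (use c e in \<open>auto simp: rank_one_update_def u_def v_def scalar_prod_def\<close>)
  have "xi = T $$ (0, 0)"
    using core_form_det[OF core] core_form_carrier(2)[OF core] det by (simp add: det_single)
  then have vu: "(\<Sum>i\<in>{0..<n}. v i * u i) = xi - 1"
    using c e by (simp add: u_def v_def scalar_prod_def)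
  have "(\<Sum>i\<in>{0..<n}. L $$ (0, i) * u i) = 1"
    using arg_cong[OF e(1), of "\<lambda>A. A $$ (0, 0)"] c by (simp add: u_def scalar_prod_def)
  then obtain k where k: "k < n" "u k \<noteq> 0" by (force intro: ccontr)
  have "(\<Sum>j\<in>{0..<n}. v j * R $$ (j, 0)) = 1"
    using arg_cong[OF e(2), of "\<lambda>A. A $$ (0, 0)"] c by (simp add: v_def scalar_prod_def)
  then obtain i where i: "i < n" "v i \<noteq> 0" by (force intro: ccontr)
  have perm: "(\<Sum>i\<in>{0..<n}. (v \<circ> p) i * (u \<circ> p) i) = xi - 1" if "p permutes {0..<n}" for p
    using sum.permute[OF that, of "\<lambda>i. v i * u i"] vu by (simp add: o_def)
  show ?thesis
  proof (cases "xi = 1")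
    case False
    define p where "p = Transposition.transpose 0 i"
    have p: "p permutes {0..<n}" unfolding p_def by (rule permutes_swap_id) (use i in auto)
    have "similar_mat z (rank_one_update n (u \<circ> p) (v \<circ> p))"
      unfolding z by (rule rank_one_update_permute[OF p])
    also have "similar_mat (rank_one_update n (u \<circ> p) (v \<circ> p))
      (rank_one_update n (\<lambda>i. if i = 0 then xi - 1 else 0) (\<lambda>j. if j = 0 then 1 else 0))"
      using i perm[OF p] False by (intro rank_one_update_similar_diagonal) (auto simp: p_def)
    finally have sim: "similar_mat z \<dots>" .
    have "Suc (n - 1) = n" using i by simp
    with sim have "similar_mat z (companion_blocks (([:- xi, 1:], 1) # replicate (n - 1) ([:- 1, 1:], 1)))"
      unfolding companion_blocks_diagonal by metis
    from has_mtype_linearI[OF det(2) False this] show ?thesis .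
  next
    case True
    \<comment> \<open>If \<open>u\<close> were supported at \<open>i\<close> alone, v u = 0 would
      force u_i = 0 and hence u = 0.\<close>
    have "\<exists>j<n. j \<noteq> i \<and> u j \<noteq> 0"
    proof (rule ccontr)
      assume no: "\<not> ?thesis"
      have "(\<Sum>j\<in>{0..<n}. v j * u j) = (\<Sum>j\<in>{0..<n}. if j = i then v j * u j else 0)"
        using no by (intro sum.cong) auto
      then have "v i * u i = 0" using vu True i by simp
      with i(2) no k show False by auto
    qed
    then obtain j where j: "j < n" "j \<noteq> i" "u j \<noteq> 0" by blast
    \<comment> \<open>Chosen so that \<open>p 0 = i\<close> and \<open>p 1 = j\<close>: the right
      factor sends 1 to the point that the left factor carries to \<open>j\<close>.\<close>
    define p where "p = Transposition.transpose 0 i \<circ> Transposition.transpose 1 (Transposition.transpose 0 i j)"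
    have n: "1 < n" using i j by linarith
    have t: "Transposition.transpose 0 i j \<noteq> 0" "Transposition.transpose 0 i j < n"
      using i j by (auto simp: Transposition.transpose_def)
    have p: "p permutes {0..<n}"
      unfolding p_def by (intro permutes_compose permutes_swap_id) (use i n t in auto)
    have p01: "p 0 = i" "p 1 = j"
      using t by (auto simp: p_def Transposition.transpose_def split: if_splits)
    have "similar_mat z (rank_one_update n (u \<circ> p) (v \<circ> p))"
      unfolding z by (rule rank_one_update_permute[OF p])
    also have "similar_mat (rank_one_update n (u \<circ> p) (v \<circ> p))
      (rank_one_update n (\<lambda>i. if i = 0 then - 1 else if i = 1 then 1 else 0) (\<lambda>j. if j < 2 then 1 else 0))"
      using i j n perm[OF p] True p01 by (intro rank_one_update_similar_unipotent) auto
    finally have sim: "similar_mat z \<dots>" .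
    have "n = (n - 2) + 2" using n by simp
    with sim have "similar_mat z (companion_blocks (([:- 1, 1:], 2) # replicate (n - 2) ([:- 1, 1:], 1)))"
      unfolding companion_blocks_unipotent by metis
    from has_mtype_transvectionI[OF this] show ?thesis by (simp add: True)
  qed
qed

lemma parts_pairs_single: "parts_pairs (single M f) = image_mset (Pair f) M"
  by (subst parts_pairs_eq_sum[of "{f}"]) (auto simp: supp_def single_def)

lemma companion_blocks_singleton: "companion_blocks [(f, k)] = companion (f ^ k)"
  by (simp add: companion_blocks_def del: diag_block_mat.simps)

lemma has_mtype_linear_iff:
  assumes "z \<in> carrier_mat n n" "xi \<noteq> 0"
  shows "has_mtype z (single {#1#} [:- xi, 1:]) \<longleftrightarrow> (\<exists>T. core_form n 1 z T) \<and> det z = xi"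
proof
  assume "has_mtype z (single {#1#} [:- xi, 1:])"
  then obtain bs m where bs: "mset bs = {#([:- xi, 1:], 1)#}" and core: "core_form n m z (companion_blocks bs)"
    using has_mtype_core_form[OF assms(1)] by (metis image_mset_single parts_pairs_single)
  from bs have "bs = [([:- xi, 1:], 1)]" by simp
  with core have core: "core_form n m z (mat 1 1 (\<lambda>_. xi))"
    by (simp add: companion_blocks_singleton companion_linear)
  from core_form_carrier(2)[OF this] have "m = 1" by auto
  with core core_form_det[OF core] show "(\<exists>T. core_form n 1 z T) \<and> det z = xi"
    by (auto simp: det_single)
qed (use core_form_one_has_mtype assms in blast)

section \<open>Products of two rank one perturbations\<close>

lemma det_mat_2:
  assumes "A \<in> carrier_mat 2 2"
  shows "det A = A $$ (0, 0) * A $$ (1, 1) - A $$ (0, 1) * (A $$ (1, 0) :: 'a :: idom)"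
proof -
  let ?e = "\<lambda>i j. mat 1 1 (\<lambda>_. A $$ (i, j))"
  have "A = four_block_mat (?e 0 0) (?e 0 1) (?e 1 0) (?e 1 1)"
    by (rule eq_matI) (use assms in \<open>auto simp: less_Suc_eq\<close>)
  moreover have "?e 1 0 * ?e 1 1 = ?e 1 1 * ?e 1 0"
    by (rule eq_matI) (auto simp: scalar_prod_def)
  ultimately have "det A = det (?e 0 0 * ?e 1 1 - ?e 0 1 * ?e 1 0)"
    using det_four_block_mat[of "?e 0 0" 1 "?e 0 1" "?e 1 0" "?e 1 1"] by simp
  also have "\<dots> = (?e 0 0 * ?e 1 1 - ?e 0 1 * ?e 1 0) $$ (0, 0)" by (rule det_single) (rule carrier_matI; simp)
  finally show ?thesis by (simp add: scalar_prod_def)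
qed

definition trace2 :: "'a :: comm_ring_1 mat \<Rightarrow> 'a" where
  "trace2 A = A $$ (0, 0) + A $$ (1, 1)"

lemma det_one_add_mat_2:
  fixes A :: "'a :: idom mat"
  assumes "A \<in> carrier_mat 2 2"
  shows "det (1\<^sub>m 2 + A) = 1 + trace2 A + det A"
  using assms by (simp add: det_mat_2[of "1\<^sub>m 2 + A"] det_mat_2[OF assms] trace2_def algebra_simps)

lemma idempotent_factorisation:
  fixes M :: "'a :: field mat"
  assumes M: "M \<in> carrier_mat 2 2" and det: "det M = 0" and tr: "trace2 M = 1"
  obtains a b where "a \<in> carrier_mat 2 1" "b \<in> carrier_mat 1 2" "M = a * b" "b * a = 1\<^sub>m 1"
proof -
  define x y w where "x = M $$ (0, 0)" and "y = M $$ (0, 1)" and "w = M $$ (1, 0)"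
  have x1: "M $$ (1, 1) = 1 - x" using tr by (simp add: trace2_def x_def algebra_simps)
  have yw: "y * w = x * (1 - x)" using det x1 by (simp add: det_mat_2[OF M] x_def y_def w_def)
  have yw': "x * M $$ (1, 1) = w * y" unfolding x1 using yw by (simp add: mult.commute)
  have M11: "M $$ (Suc 0, Suc 0) = (if x = 0 then 1 else w * y / x)"
    using yw' x1 by (simp add: nonzero_eq_divide_eq mult.commute)
  \<comment> \<open>By Cayley-Hamilton \<open>M\<close> is an idempotent of rank one, so any nonzero
    row can serve as \<open>b\<close>: the first row if \<open>x\<close> is nonzero, and otherwise
    the second row, whose last entry is 1.\<close>
  define a where "a = mat 2 1 (\<lambda>(i, _). if x = 0 then if i = 0 then y else 1 else if i = 0 then 1 else w / x)"
  define b where "b = mat 1 2 (\<lambda>(_, j). if x = 0 then if j = 0 then w else 1 else if j = 0 then x else y)"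
  have "M = a * b"
  proof (rule eq_matI)
    fix i j assume "i < dim_row (a * b)" "j < dim_col (a * b)"
    then have "i \<in> {0, 1}" "j \<in> {0, 1}" by (auto simp: a_def b_def less_2_cases_iff)
    then show "M $$ (i, j) = (a * b) $$ (i, j)"
      using yw M11
      by (auto simp: a_def b_def scalar_prod_def x_def[symmetric, simplified] y_def[symmetric, simplified]
          w_def[symmetric, simplified] field_simps)
  qed (use M in \<open>auto simp: a_def b_def\<close>)
  moreover have "b * a = 1\<^sub>m 1"
    by (rule eq_matI) (use yw in \<open>auto simp: a_def b_def scalar_prod_def numeral_2_eq_2 field_simps\<close>)
  moreover have "a \<in> carrier_mat 2 1" "b \<in> carrier_mat 1 2" by (auto simp: a_def b_def)
  ultimately show ?thesis using that by blast
qed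

text \<open>A factorisation \<open>1 + P Q = (1 + p q) y\<close> into two rank one perturbations of the identity
  splits \<open>P Q\<close> into two rank one summands. Comparing column and row spaces, \<open>p q\<close> factors
  through \<open>P\<close> and \<open>Q\<close>, and the middle factor \<open>M\<close> is an idempotent of rank one.\<close>

lemma rank_two_splitting:
  fixes P :: "'a :: field mat"
  assumes c: "P \<in> carrier_mat n 2" "Q \<in> carrier_mat 2 n" "L \<in> carrier_mat 2 n" "R \<in> carrier_mat n 2"
    and LP: "L * P = 1\<^sub>m 2" and QR: "Q * R = 1\<^sub>m 2"
    and pq: "p \<in> carrier_mat n 1" "q \<in> carrier_mat 1 n" "p' \<in> carrier_mat n 1" "q' \<in> carrier_mat 1 n"
    and split: "P * Q = p * q + p' * q'"
  obtains M where "M \<in> carrier_mat 2 2" "p * q = P * M * Q" "det M = 0" "trace2 M = 1"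
proof -
  \<comment> \<open>\<open>U\<close> joins the two columns and \<open>V\<close> the two rows, giving
    a second factorisation of \<open>P * Q\<close> through dimension 2; \<open>E\<close> and
    \<open>F\<close> select the first summand.\<close>
  define U where "U = mat n 2 (\<lambda>(i, j). if j = 0 then p $$ (i, 0) else p' $$ (i, 0))"
  define V where "V = mat 2 n (\<lambda>(i, j). if i = 0 then q $$ (0, j) else q' $$ (0, j))"
  define E :: "'a mat" where "E = mat 2 1 (\<lambda>(i, j). if i = 0 then 1 else 0)"
  define F :: "'a mat" where "F = mat 1 2 (\<lambda>(i, j). if j = 0 then 1 else 0)"
  have d: "U \<in> carrier_mat n 2" "V \<in> carrier_mat 2 n" "E \<in> carrier_mat 2 1" "F \<in> carrier_mat 1 2"
    by (auto simp: U_def V_def E_def F_def)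
  note [simp] = c[THEN carrier_matD(1)] c[THEN carrier_matD(2)] d[THEN carrier_matD(1)]
    d[THEN carrier_matD(2)] pq[THEN carrier_matD(1)] pq[THEN carrier_matD(2)]
  have UV: "U * V = P * Q"
    unfolding split
  proof (rule eq_matI)
    fix i j assume "i < dim_row (p * q + p' * q')" "j < dim_col (p * q + p' * q')"
    then have ij: "i < n" "j < n" by auto
    then have "(U * V) $$ (i, j) = p $$ (i, 0) * q $$ (0, j) + p' $$ (i, 0) * q' $$ (0, j)"
      by (simp add: U_def V_def scalar_prod_def numeral_2_eq_2)
    with ij show "(U * V) $$ (i, j) = (p * q + p' * q') $$ (i, j)" by (simp add: scalar_prod_def)
  qed simp_all
  have UE: "U * E = p"
  proof (rule eq_matI)
    fix i j assume "i < dim_row p" "j < dim_col p"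
    then show "(U * E) $$ (i, j) = p $$ (i, j)"
      by (simp add: U_def E_def scalar_prod_def numeral_2_eq_2)
  qed simp_all
  have FV: "F * V = q"
  proof (rule eq_matI)
    fix i j assume "i < dim_row q" "j < dim_col q"
    then show "(F * V) $$ (i, j) = q $$ (i, j)"
      by (simp add: V_def F_def scalar_prod_def numeral_2_eq_2)
  qed simp_all
  have FE: "F * E = 1\<^sub>m 1"
    by (rule eq_matI) (auto simp: E_def F_def scalar_prod_def numeral_2_eq_2)
  \<comment> \<open>Two rank factorisations of one matrix differ by an invertible middle matrix:
    \<open>P = U * B\<close> and \<open>Q = A * V\<close> with \<open>A\<close> and \<open>B\<close>
    mutually inverse.\<close>
  define A where "A = L * U"
  define B where "B = V * R"
  have AB: "A \<in> carrier_mat 2 2" "B \<in> carrier_mat 2 2" by (rule carrier_matI; simp add: A_def B_def)+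
  note [simp] = AB[THEN carrier_matD(1)] AB[THEN carrier_matD(2)]
  have PB: "P = U * B"
  proof -
    have "U * B = P * Q * R" by (simp add: B_def mat_dim_simps flip: UV)
    also have "\<dots> = P" using c by (simp add: mat_dim_simps QR)
    finally show ?thesis by simp
  qed
  have QA: "Q = A * V"
  proof -
    have "A * V = L * (P * Q)" by (simp add: A_def mat_dim_simps flip: UV)
    also have "\<dots> = Q" by (simp add: mult_mat_cancel_dim[OF LP])
    finally show ?thesis by simp
  qed
  have "A * B = L * (U * B)" by (simp add: A_def mat_dim_simps)
  also have "\<dots> = 1\<^sub>m 2" by (simp add: LP flip: PB)
  finally have ABone: "A * B = 1\<^sub>m 2" .
  have BA: "B * A = 1\<^sub>m 2" by (rule mat_mult_left_right_inverse[OF AB ABone])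
  \<comment> \<open>The coordinate projection \<open>E * F\<close>, conjugated by
    \<open>A\<close>.\<close>
  define M where "M = A * E * (F * B)"
  have M: "M \<in> carrier_mat 2 2" by (rule carrier_matI; simp add: M_def)
  have "P * M * Q = U * (B * (A * (E * (F * (B * (A * V))))))"
    unfolding M_def PB QA by (simp add: mat_dim_simps)
  also have "\<dots> = (U * E) * (F * V)" by (simp add: mat_dim_simps mult_mat_cancel_dim[OF BA])
  finally have "p * q = P * M * Q" by (simp add: UE FV)
  moreover have detM: "det M = 0"
  proof -
    have "det (E * F) = 0" 
      by (subst det_mat_2, rule carrier_matI; simp add: E_def F_def scalar_prod_def)
    moreover have "M = A * (E * F) * B" by (simp add: M_def mat_dim_simps)
    moreover have "E * F \<in> carrier_mat 2 2" by (rule carrier_matI; simp)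
    ultimately show ?thesis using AB by (simp add: det_mult[of _ 2])
  qed
  moreover have "trace2 M = 1"
  proof -
    \<comment> \<open>The trace is extracted from det (1 + M) = 1 + trace2 M + det M: swapping the
      two factors of \<open>M\<close> turns the left side into 1 + 1.\<close>
    have "F * B * (A * E) = 1\<^sub>m 1" by (simp add: mat_dim_simps mult_mat_cancel_dim[OF BA] FE)
    moreover have "det (1\<^sub>m 2 + M) = det (1\<^sub>m 1 + F * B * (A * E))"
      unfolding M_def by (rule det_one_add_mult_commute) (rule carrier_matI; simp)+
    ultimately have "det (1\<^sub>m 2 + M) = det (1\<^sub>m 1 + 1\<^sub>m 1 :: 'a mat)" by simp
    also have "\<dots> = 1 + 1" by (subst det_single) auto
    finally show ?thesis using det_one_add_mat_2[OF M] detM by (simp add: algebra_simps)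
  qed
  ultimately show ?thesis using M that by blast
qed

text \<open>Determinant 0 and trace 1 describe the idempotents of rank one. For them det (1 + P M Q)
  = det (1 + M Q P) = 1 + tr (M (T - 1)) = tr (M T), so the last condition fixes the determinant of
  the first factor.\<close>

definition splittings :: "'a :: field \<Rightarrow> 'a mat \<Rightarrow> 'a mat set" where
  "splittings xi T = {M \<in> carrier_mat 2 2. det M = 0 \<and> trace2 M = 1 \<and> trace2 (M * T) = xi}"

lemma trace2_mult_one_add:
  assumes "M \<in> carrier_mat 2 2" "N \<in> carrier_mat 2 2"
  shows "trace2 (M * (1\<^sub>m 2 + N)) = trace2 M + trace2 (M * N)"
  using assms by (simp add: mult_add_distrib_mat[of _ 2 2 _ 2] trace2_def)

text \<open>As x is invertible it determines y, so pairs are counted by x = 1 + P M Q; and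
  \<open>L\<close>, \<open>R\<close> recover \<open>M\<close> from x. For the converse, the
  complementary idempotent 1 - M supplies the second factor.\<close>

lemma coeff_prod_eq_card_splittings:
  fixes z :: "'a :: field mat"
  assumes core: "core_form n 2 z T" and det: "det z = xi * eta" and nz: "xi \<noteq> 0" "eta \<noteq> 0"
  shows "coeff_prod (single {#1#} [:- xi, 1:]) (single {#1#} [:- eta, 1:]) n z = card (splittings xi T)"
proof -
  from core obtain P Q L R where
    c: "P \<in> carrier_mat n 2" "Q \<in> carrier_mat 2 n" "L \<in> carrier_mat 2 n" "R \<in> carrier_mat n 2"
    and e: "L * P = 1\<^sub>m 2" "Q * R = 1\<^sub>m 2" "z = 1\<^sub>m n + P * Q" "T = 1\<^sub>m 2 + Q * P"
    by (elim core_formE)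
  note [simp] = c[THEN carrier_matD(1)] c[THEN carrier_matD(2)]
  have z: "z \<in> carrier_mat n n" using core_form_carrier[OF core] by simp
  have QP: "Q * P \<in> carrier_mat 2 2" using c by auto
  let ?X = "{(x, y). x \<in> GL n \<and> y \<in> GL n \<and> has_mtype x (single {#1#} [:- xi, 1:])
     \<and> has_mtype y (single {#1#} [:- eta, 1:]) \<and> x * y = z}"
  let ?h = "\<lambda>M. 1\<^sub>m n + P * M * Q"
  have det_h: "det (?h M) = trace2 (M * T)"
    if M: "M \<in> carrier_mat 2 2" "det M = 0" "trace2 M = 1" for M
  proof -
    have *: "P * M \<in> carrier_mat n 2" "M * (Q * P) \<in> carrier_mat 2 2" using c M by auto
    have "det (?h M) = det (1\<^sub>m 2 + Q * (P * M))"
      by (rule det_one_add_mult_commute[OF *(1) c(2)])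
    also have "Q * (P * M) = Q * P * M" using c M by simp
    also have "det (1\<^sub>m 2 + Q * P * M) = det (1\<^sub>m 2 + M * (Q * P))"
      by (rule det_one_add_mult_commute[OF QP M(1)])
    also have "\<dots> = trace2 M + trace2 (M * (Q * P))"
      using M QP by (simp add: det_one_add_mat_2[OF *(2)] det_mult[of _ 2])
    also have "\<dots> = trace2 (M * T)" unfolding e(4) using M(1) QP by (simp add: trace2_mult_one_add)
    finally show ?thesis .
  qed
  have inv_h: "L * (?h M + (- 1\<^sub>m n)) * R = M" if M: "M \<in> carrier_mat 2 2" for M
  proof -
    note [simp] = carrier_matD[OF M]
    have "?h M + (- 1\<^sub>m n) = P * (M * Q)"
      using c M by (intro eq_matI) (simp_all add: assoc_mult_mat[of _ n 2 _ 2 _ n])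
    then have "L * (?h M + (- 1\<^sub>m n)) * R = L * (P * (M * Q)) * R" by simp
    also have "\<dots> = M" using M by (simp add: mat_dim_simps e mult_mat_cancel_dim[OF e(1)])
    finally show ?thesis .
  qed
  have "bij_betw fst ?X (?h ` splittings xi T)"
    unfolding bij_betw_def
  proof
    show "inj_on fst ?X"
    proof (rule inj_onI, clarsimp)
      fix x y y' assume x: "x \<in> GL n" and y: "y \<in> GL n" "y' \<in> GL n" and xy: "x * y' = x * y"
      from x y have c: "x \<in> carrier_mat n n" "y \<in> carrier_mat n n" "y' \<in> carrier_mat n n"
        and "det x \<noteq> 0" by (auto simp: GL_def)
      then obtain x' where x': "x' \<in> carrier_mat n n" "x' * x = 1\<^sub>m n" by (metis invertible_matE)
      from xy have "x' * (x * y') = x' * (x * y)" by simp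
      with x' c show "y = y'" by (simp flip: assoc_mult_mat[of _ n n _ n _ n])
    qed
    show "fst ` ?X = ?h ` splittings xi T"
    proof (intro equalityI subsetI)
      fix x assume "x \<in> fst ` ?X"
      then obtain y where x: "x \<in> carrier_mat n n" and y: "y \<in> carrier_mat n n"
        and tx: "has_mtype x (single {#1#} [:- xi, 1:])" and ty: "has_mtype y (single {#1#} [:- eta, 1:])"
        and xy: "x * y = z"
        by (auto simp: GL_def)
      from tx obtain t1 where dx: "det x = xi" and "core_form n 1 x t1"
        using has_mtype_linear_iff[OF x nz(1)] by auto
      then obtain p q where p: "p \<in> carrier_mat n 1" "q \<in> carrier_mat 1 n" "x = 1\<^sub>m n + p * q"
        by (auto elim: core_formE)
      from ty obtain t2 where "core_form n 1 y t2"
        using has_mtype_linear_iff[OF y nz(2)] by auto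
      then obtain p' q' where p': "p' \<in> carrier_mat n 1" "q' \<in> carrier_mat 1 n" "y = 1\<^sub>m n + p' * q'"
        by (auto elim: core_formE)
      \<comment> \<open>Absorbs \<open>x\<close> into the column of the second factor: z = x + (x
        p') q', so \<open>P * Q\<close> becomes a sum of two products of a column and a row.\<close>
      define w where "w = x * p'"
      have w: "w \<in> carrier_mat n 1" using x p' by (simp add: w_def)
      have pqw: "p * q \<in> carrier_mat n n" "w * q' \<in> carrier_mat n n" using p p' w by auto
      have "z = x + w * q'"
        unfolding xy[symmetric] p'(3) w_def using x p' by (simp add: mult_add_distrib_mat[of _ n n _ n])
      then have sum: "1\<^sub>m n + P * Q = 1\<^sub>m n + (p * q + w * q')"
        unfolding e(3) p(3) using pqw by (simp add: assoc_add_mat[of _ n n])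
      have PQ: "P * Q = p * q + w * q'"
      proof (rule eq_matI)
        fix i j assume "i < dim_row (p * q + w * q')" "j < dim_col (p * q + w * q')"
        then have "i < n" "j < n" using pqw by auto
        then show "(P * Q) $$ (i, j) = (p * q + w * q') $$ (i, j)"
          using arg_cong[OF sum, of "\<lambda>A. A $$ (i, j)"] pqw w p' p by (simp del: index_mult_mat(1))
      qed (use w p p' in auto)
      obtain M where M: "M \<in> carrier_mat 2 2" "p * q = P * M * Q" "det M = 0" "trace2 M = 1"
        by (rule rank_two_splitting[OF c e(1,2) p(1,2) w p'(2) PQ])
      then have "x = ?h M" using p(3) by simp
      moreover have "M \<in> splittings xi T"
        using M det_h[OF M(1,3,4)] dx \<open>x = ?h M\<close> by (simp add: splittings_def)
      ultimately show "x \<in> ?h ` splittings xi T" by blast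
    next
      fix x assume "x \<in> ?h ` splittings xi T"
      then obtain M where x: "x = ?h M" and M: "M \<in> carrier_mat 2 2" "det M = 0" "trace2 M = 1"
        and "trace2 (M * T) = xi" by (auto simp: splittings_def)
      with det_h have dx: "det x = xi" by auto
      have xc: "x \<in> carrier_mat n n" using x c M by auto
      obtain x' where x': "x' \<in> carrier_mat n n" "x * x' = 1\<^sub>m n" "x' * x = 1\<^sub>m n"
        using invertible_matE[OF xc] dx nz by metis
      obtain a b where ab: "a \<in> carrier_mat 2 1" "b \<in> carrier_mat 1 2" "M = a * b" "b * a = 1\<^sub>m 1"
        using idempotent_factorisation[OF M] by blast
      define M' where "M' = 1\<^sub>m 2 + (- M)"
      have M': "M' \<in> carrier_mat 2 2" "M + M' = 1\<^sub>m 2"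
        using M by (auto simp: M'_def)
      have "det M' = 0" "trace2 M' = 1"
        using M by (auto simp: M'_def det_one_add_mat_2 det_mat_2 trace2_def algebra_simps)
      then obtain a' b' where ab': "a' \<in> carrier_mat 2 1" "b' \<in> carrier_mat 1 2" "M' = a' * b'" "b' * a' = 1\<^sub>m 1"
        using idempotent_factorisation[OF M'(1)] by blast
      note [simp] = xc[THEN carrier_matD(1)] xc[THEN carrier_matD(2)] x'(1)[THEN carrier_matD(1)]
        x'(1)[THEN carrier_matD(2)] ab(1,2)[THEN carrier_matD(1)] ab(1,2)[THEN carrier_matD(2)]
        ab'(1,2)[THEN carrier_matD(1)] ab'(1,2)[THEN carrier_matD(2)]
      \<comment> \<open>Solves x y = z: with \<open>x'\<close> the inverse of \<open>x\<close>,
        multiplying by \<open>x\<close> gives x + P (1 - M) Q = 1 + P Q.\<close>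
      define y where "y = 1\<^sub>m n + (x' * (P * a')) * (b' * Q)"
      have coreG: "core_form n 1 (1\<^sub>m n + p * q) (1\<^sub>m 1 + q * p)"
        if "p \<in> carrier_mat n 1" "q \<in> carrier_mat 1 n" "l \<in> carrier_mat 1 n" "r \<in> carrier_mat n 1"
          "l * p = 1\<^sub>m 1" "q * r = 1\<^sub>m 1" for p q l r :: "'a mat"
        by (rule core_formI[OF that]) auto
      have "x = 1\<^sub>m n + (P * a) * (b * Q)" unfolding x ab(3) by (simp add: mat_dim_simps)
      moreover have "core_form n 1 (1\<^sub>m n + (P * a) * (b * Q)) (1\<^sub>m 1 + (b * Q) * (P * a))"
        by (rule coreG[where l = "b * L" and r = "R * a"])
          (auto simp: mat_dim_simps mult_mat_cancel_dim[OF e(1)] mult_mat_cancel_dim[OF e(2)] ab(4))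
      ultimately have tx: "has_mtype x (single {#1#} [:- xi, 1:])"
        using has_mtype_linear_iff[OF xc nz(1)] dx by auto
      have yc: "y \<in> carrier_mat n n" by (auto simp: y_def)
      have xy: "x * y = z"
      proof -
        have "x * y = x + P * M' * Q"
          by (simp add: y_def mat_dim_simps ab'(3) mult_mat_cancel_dim[OF x'(2)] right_mult_one_mat[OF xc])
        also have "\<dots> = 1\<^sub>m n + (P * M * Q + P * M' * Q)"
          unfolding x using c M M' by (simp add: assoc_add_mat[of _ n n])
        also have "P * M * Q + P * M' * Q = P * (M + M') * Q"
          using M(1)[THEN carrier_matD(1)] M(1)[THEN carrier_matD(2)]
            M'(1)[THEN carrier_matD(1)] M'(1)[THEN carrier_matD(2)]
          by (simp add: mat_dim_simps)
        also have "\<dots> = P * Q" using c by (simp add: M'(2))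
        finally show ?thesis using e(3) by simp
      qed
      have "det x * det y = xi * eta" using det_mult[OF xc yc] xy det by simp
      with dx nz have dy: "det y = eta" by simp
      have "core_form n 1 y (1\<^sub>m 1 + (b' * Q) * (x' * (P * a')))"
        unfolding y_def
        by (rule coreG[where l = "b' * (L * x)" and r = "R * a'"])
          (auto simp: mat_dim_simps mult_mat_cancel_dim[OF e(1)] mult_mat_cancel_dim[OF e(2)]
            mult_mat_cancel_dim[OF x'(2)] ab'(4))
      then have "has_mtype y (single {#1#} [:- eta, 1:])"
        using has_mtype_linear_iff[OF yc nz(2)] dy by auto
      with tx xy dx dy nz xc yc have "(x, y) \<in> ?X" by (simp add: GL_def)
      then show "x \<in> fst ` ?X" by force
    qed
  qed
  then have "card ?X = card (?h ` splittings xi T)" by (rule bij_betw_same_card)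
  also have "\<dots> = card (splittings xi T)"
    by (rule card_image, rule inj_on_inverseI[where g = "\<lambda>x. L * (x + (- 1\<^sub>m n)) * R"])
      (auto simp: splittings_def inv_h)
  finally show ?thesis by (simp add: coeff_prod_def)
qed

section \<open>Counting the idempotents\<close>

lemma card_splittings:
  assumes T: "T \<in> carrier_mat 2 2"
  shows "card (splittings xi T) = card {(x, y, w). y * w = x * (1 - x) \<and>
    x * T $$ (0, 0) + y * T $$ (1, 0) + w * T $$ (0, 1) + (1 - x) * T $$ (1, 1) = xi}" (is "_ = card ?C")
proof -
  let ?M = "\<lambda>(x, y, w). mat 2 2 (\<lambda>(i, j). if i = 0 then if j = 0 then x else y else if j = 0 then w else 1 - x)"
  have "bij_betw ?M ?C (splittings xi T)"
  proof (rule bij_betw_byWitness[where f' = "\<lambda>M. (M $$ (0, 0), M $$ (0, 1), M $$ (1, 0))"])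
    show "\<forall>M\<in>splittings xi T. ?M (M $$ (0, 0), M $$ (0, 1), M $$ (1, 0)) = M"
    proof
      fix M assume "M \<in> splittings xi T"
      then have M: "M \<in> carrier_mat 2 2" and "M $$ (0, 0) + M $$ (1, 1) = 1"
        by (auto simp: splittings_def trace2_def)
      then have "M $$ (1, 1) = 1 - M $$ (0, 0)" by (simp add: algebra_simps)
      with M show "?M (M $$ (0, 0), M $$ (0, 1), M $$ (1, 0)) = M"
        by (intro eq_matI) (auto simp: less_Suc_eq numeral_2_eq_2)
    qed
    show "?M ` ?C \<subseteq> splittings xi T"
      using T by (auto simp: splittings_def trace2_def det_mat_2 scalar_prod_def numeral_2_eq_2 algebra_simps)
    show "(\<lambda>M. (M $$ (0, 0), M $$ (0, 1), M $$ (1, 0))) ` splittings xi T \<subseteq> ?C"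
    proof clarify
      fix M assume "M \<in> splittings xi T"
      then have M: "M \<in> carrier_mat 2 2" and tr: "M $$ (0, 0) + M $$ (1, 1) = 1"
        and det: "M $$ (0, 0) * M $$ (1, 1) - M $$ (0, 1) * M $$ (1, 0) = 0" and trT: "trace2 (M * T) = xi"
        by (auto simp: splittings_def trace2_def det_mat_2)
      from tr have "M $$ (1, 1) = 1 - M $$ (0, 0)" by (simp add: algebra_simps)
      with det trT M T show "M $$ (0, 1) * M $$ (1, 0) = M $$ (0, 0) * (1 - M $$ (0, 0)) \<and>
          M $$ (0, 0) * T $$ (0, 0) + M $$ (0, 1) * T $$ (1, 0) + M $$ (1, 0) * T $$ (0, 1) +
          (1 - M $$ (0, 0)) * T $$ (1, 1) = xi"
        by (simp add: trace2_def scalar_prod_def numeral_2_eq_2 add.assoc)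
    qed
  qed auto
  then show ?thesis by (rule bij_betw_same_card[symmetric])
qed

text \<open>For scalar T the trace of M T is c times the trace of M, that is c. If c = xi, all rank
  one idempotents count: q (q - 1) of them with y nonzero, and 2 q with y = 0, where x is 0 or 1 and
  w is free.\<close>

lemma card_splittings_scalar:
  fixes c xi :: "'a :: {finite, field}"
  shows "card (splittings xi (mat 2 2 (\<lambda>(i, j). if i = j then c else 0))) =
    (if c = xi then card (UNIV :: 'a set) ^ 2 + card (UNIV :: 'a set) else 0)"
proof -
  let ?q = "card (UNIV :: 'a set)"
  let ?C = "{(x, y, w). y * w = x * (1 - x :: 'a)}"
  let ?C1 = "(\<lambda>(x, y). (x, y, x * (1 - x) / y)) ` (UNIV \<times> (UNIV - {0 :: 'a}))"
  let ?C2 = "{0, 1 :: 'a} \<times> {0 :: 'a} \<times> (UNIV :: 'a set)"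
  have "?C = ?C1 \<union> ?C2"
  proof (intro equalityI subsetI)
    fix t assume "t \<in> ?C"
    then obtain x y w where t: "t = (x, y, w)" and yw: "y * w = x * (1 - x)" by auto
    show "t \<in> ?C1 \<union> ?C2"
    proof (cases "y = 0")
      case False
      then have "w = x * (1 - x) / y" using yw by (simp add: nonzero_eq_divide_eq mult.commute)
      with False t show ?thesis by auto
    qed (use t yw in auto)
  qed (auto split: if_splits)
  moreover have "card (?C1 \<union> ?C2) = card ?C1 + card ?C2"
    by (rule card_Un_disjoint) auto
  moreover have "card ?C1 = ?q * (?q - 1)"
    by (subst card_image) (auto simp: inj_on_def card_cartesian_product card_Diff_singleton)
  moreover have "card ?C2 = 2 * ?q" by (simp add: card_cartesian_product)
  moreover have "?q * (?q - 1) + 2 * ?q = ?q ^ 2 + ?q"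
    by (cases ?q) (simp_all add: power2_eq_square)
  ultimately have "card ?C = ?q ^ 2 + ?q" by simp
  moreover have "x * c + (1 - x) * c = c" for x by (simp add: algebra_simps)
  ultimately show ?thesis by (subst card_splittings) simp_all
qed

text \<open>For \<open>T\<close> a companion matrix of \<open>p\<close> the splittings form an affine conic through the points
  \<open>(0, 0)\<close> and \<open>(1, 0)\<close> in the coordinates \<open>(x, w)\<close>; the other points are parametrised by the
  slope \<open>k = (1 - x) / w\<close>, which satisfies \<open>w p(k) = k - \<xi>\<close>.\<close>

lemma card_splittings_companion:
  fixes p :: "'a :: {finite, field} poly"
  assumes lc: "lead_coeff p = 1" and deg: "degree p = 2"
  shows "card (splittings xi (companion p)) + card {k. poly p k = 0} =
    card (UNIV :: 'a set) + 1 + (if poly p xi = 0 then card (UNIV :: 'a set) else 0)"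
proof -
  let ?q = "card (UNIV :: 'a set)"
  \<comment> \<open>Determinant and trace of the companion matrix.\<close>
  define d s where "d = coeff p 0" and "s = - coeff p 1"
  have p: "poly p k = d - s * k + k * k" for k
    using lc deg by (simp add: poly_altdef d_def s_def numeral_2_eq_2 algebra_simps)
  have T: "companion p \<in> carrier_mat 2 2" using deg companion_carrier[of p] by simp
  let ?C = "{(x, y, w). y * w = x * (1 - x) \<and> y - d * w + s * (1 - x) = xi}"
  have "card (splittings xi (companion p)) = card ?C"
    unfolding card_splittings[OF T]
    using deg by (intro arg_cong[of _ _ card]) (auto simp: companion_def d_def s_def algebra_simps)
  \<comment> \<open>The slope needs w nonzero; the two points with w = 0 are added separately
    below.\<close>
  define B where "B = {(k, w). w \<noteq> 0 \<and> w * poly p k = k - xi}"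
  let ?g = "\<lambda>(k, w). (1 - k * w, xi + d * w - s * k * w, w)"
  have C: "?C = ?g ` B \<union> {(0, xi - s, 0), (1, xi, 0)}" (is "_ = _ \<union> ?E")
  proof (intro equalityI subsetI)
    fix c assume "c \<in> ?C"
    then obtain x y w where c: "c = (x, y, w)" and 1: "y * w = x * (1 - x)" and 2: "y - d * w + s * (1 - x) = xi"
      by auto
    have y: "y = xi + d * w - s * (1 - x)" using 2 by (simp add: algebra_simps)
    show "c \<in> ?g ` B \<union> ?E"
    proof (cases "w = 0")
      case True
      with 1 y c show ?thesis by auto
    next
      case False
      define k where "k = (1 - x) / w"
      have x: "x = 1 - k * w" using False by (simp add: k_def)
      have "w * (xi + d * w - s * k * w) = w * (k - k * k * w)"
        using 1 unfolding y x by (simp add: algebra_simps)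
      then have "xi + d * w - s * k * w = k - k * k * w" using False by simp
      then have "(k, w) \<in> B" using False by (simp add: B_def p algebra_simps)
      moreover have "c = ?g (k, w)" by (simp add: c x y algebra_simps)
      ultimately show ?thesis by blast
    qed
  next
    fix c assume "c \<in> ?g ` B \<union> ?E"
    then show "c \<in> ?C"
    proof
      assume "c \<in> ?g ` B"
      then obtain k w where c: "c = ?g (k, w)" and B: "(k, w) \<in> B" by auto
      then have "xi + d * w - s * k * w = k - k * k * w" by (simp add: B_def p algebra_simps)
      then have "(xi + d * w - s * k * w) * w = (k - k * k * w) * w" by simp
      then show ?thesis by (simp add: c algebra_simps)
    qed auto
  qed
  have "card ?C = card (?g ` B) + card ?E"
    unfolding C by (rule card_Un_disjoint) (auto simp: B_def)
  also have "card (?g ` B) = card B"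
    by (rule card_image) (auto simp: inj_on_def B_def)
  also have "card ?E = 2" by simp
  finally have "card ?C = card B + 2" .
  let ?Z = "{k. poly p k = 0}"
  have "card B + card ?Z + 1 = ?q + (if poly p xi = 0 then ?q else 0)"
  proof -
    \<comment> \<open>A slope that is not a root of \<open>p\<close> determines w, which is nonzero
      unless the slope is \<open>xi\<close>. A root is admissible only if it equals
      \<open>xi\<close>, and then every nonzero w occurs.\<close>
    let ?B1 = "(\<lambda>k. (k, (k - xi) / poly p k)) ` (UNIV - insert xi ?Z)"
    let ?B2 = "if poly p xi = 0 then {xi} \<times> (UNIV - {0 :: 'a}) else {}"
    have "B = ?B1 \<union> ?B2"
      by (auto simp: B_def image_iff field_simps split: if_splits)
    moreover have "card (?B1 \<union> ?B2) = card ?B1 + card ?B2"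
      by (rule card_Un_disjoint) auto
    moreover have "card ?B1 = ?q - card (insert xi ?Z)"
      by (subst card_image) (auto simp: inj_on_def card_Diff_subset)
    moreover have "card ?B2 = (if poly p xi = 0 then ?q - 1 else 0)"
      by (simp add: card_cartesian_product card_Diff_singleton)
    moreover have "card (insert xi ?Z) = (if poly p xi = 0 then card ?Z else card ?Z + 1)"
      by (auto simp: insert_absorb)
    moreover have "card (insert xi ?Z) \<le> ?q" by (rule card_mono) auto
    moreover have "?q > 0" by (simp add: card_gt_0_iff)
    ultimately show ?thesis by auto
  qed
  with \<open>card ?C = card B + 2\<close> \<open>card (splittings xi (companion p)) = card ?C\<close>
  show ?thesis by simp
qed

text \<open>The Chinese remainder theorem for F[t]/((t-a)(t-b)): the conjugating matrix evaluates 1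
  and t at \<open>a\<close> and \<open>b\<close>, and its inverse is Lagrange interpolation, whence
  the denominators \<open>b - a\<close>.\<close>

lemma diagonal_similar_companion:
  fixes a b :: "'a :: field"
  assumes "a \<noteq> b"
  shows "similar_mat (companion_blocks [([:- a, 1:], 1), ([:- b, 1:], 1)]) (companion ([:- a, 1:] * [:- b, 1:]))"
proof -
  let ?m = "\<lambda>x y w v :: 'a. mat 2 2 (\<lambda>(i, j). if i = 0 then if j = 0 then x else y else if j = 0 then w else v)"
  have T: "companion_blocks [([:- a, 1:], 1), ([:- b, 1:], 1)] = ?m a 0 0 b"
    by (rule eq_matI) (auto simp: companion_blocks_Cons companion_linear less_Suc_eq)
  have C: "companion ([:- a, 1:] * [:- b, 1:]) = ?m 0 (- (a * b)) 1 (a + b)"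
    by (rule eq_matI) (auto simp: companion_def less_Suc_eq numeral_2_eq_2)
  have mult: "?m x y w v * ?m x' y' w' v' =
      ?m (x * x' + y * w') (x * y' + y * v') (w * x' + v * w') (w * y' + v * v')" for x y w v x' y' w' v'
    by (rule eq_matI) (auto simp: scalar_prod_def numeral_2_eq_2 less_Suc_eq)
  have one: "1\<^sub>m 2 = ?m 1 0 0 1" by (rule eq_matI) (auto simp: less_Suc_eq numeral_2_eq_2)
  have "b - a \<noteq> 0" using assms by simp
  have cong: "?m x y w v = ?m x' y' w' v'" if "x = x'" "y = y'" "w = w'" "v = v'" for x y w v x' y' w' v'
    by (simp only: that)
  have "?m 1 a 1 b * ?m (b / (b - a)) (- a / (b - a)) (- 1 / (b - a)) (1 / (b - a)) = 1\<^sub>m 2"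
    "?m (b / (b - a)) (- a / (b - a)) (- 1 / (b - a)) (1 / (b - a)) * ?m 1 a 1 b = 1\<^sub>m 2"
    "?m a 0 0 b = ?m 1 a 1 b * ?m 0 (- (a * b)) 1 (a + b) *
       ?m (b / (b - a)) (- a / (b - a)) (- 1 / (b - a)) (1 / (b - a))"
    unfolding mult one by (rule cong; use \<open>b - a \<noteq> 0\<close> in \<open>simp add: divide_simps\<close>; simp add: algebra_simps)+
  then show ?thesis unfolding T C by (intro similar_matI[where n = 2]) auto
qed

section \<open>The coefficients for each modified type of norm two\<close>

lemma coeff_prod_companion:
  fixes p :: "'a :: {finite, field} poly"
  assumes "core_form n 2 z (companion p)" "lead_coeff p = 1" "degree p = 2"
    "det z = xi * eta" "xi \<noteq> 0" "eta \<noteq> 0"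
  shows "coeff_prod (single {#1#} [:- xi, 1:]) (single {#1#} [:- eta, 1:]) n z + card {k. poly p k = 0} =
    card (UNIV :: 'a set) + 1 + (if poly p xi = 0 then card (UNIV :: 'a set) else 0)"
  using coeff_prod_eq_card_splittings[OF assms(1,4-6)] card_splittings_companion[OF assms(2,3)] by simp

lemma coeff_prod_eq_0:
  assumes "z \<in> carrier_mat n n" "det z \<noteq> xi * eta" "xi \<noteq> 0" "eta \<noteq> 0"
  shows "coeff_prod (single {#1#} [:- xi, 1:]) (single {#1#} [:- eta, 1:]) n z = 0"
proof -
  have "x * y \<noteq> z"
    if "x \<in> GL n" "y \<in> GL n" "has_mtype x (single {#1#} [:- xi, 1:])" "has_mtype y (single {#1#} [:- eta, 1:])"
    for x y
    using that assms has_mtype_linear_iff[of x n xi] has_mtype_linear_iff[of y n eta] det_mult[of x n y]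
    by (auto simp: GL_def)
  then have empty: "{(x, y). x \<in> GL n \<and> y \<in> GL n \<and> has_mtype x (single {#1#} [:- xi, 1:])
       \<and> has_mtype y (single {#1#} [:- eta, 1:]) \<and> x * y = z} = {}" by blast
  show ?thesis unfolding coeff_prod_def empty by simp
qed

lemma mset_eq_pairE:
  assumes "mset xs = {#a, b#}"
  obtains "xs = [a, b]" | "xs = [b, a]"
proof -
  have "length xs = 2" using arg_cong[OF assms, of size] by simp
  then obtain x y where "xs = [x, y]" by (auto simp: length_Suc_conv numeral_2_eq_2)
  with assms that show ?thesis by (auto simp: add_eq_conv_ex)
qed

lemma parts_pairs_punion_single:
  "parts_pairs (punion (single M f) (single N g)) = image_mset (Pair f) M + image_mset (Pair g) N"
  by (subst parts_pairs_eq_sum[of "{f, g}"]) (auto simp: supp_def single_def punion_def sum.distrib if_distrib cong: if_cong)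

lemma core_form_two_linear:
  assumes "z \<in> carrier_mat n n" "has_mtype z (punion (single {#1#} [:- a, 1:]) (single {#1#} [:- b, 1:]))"
  shows "if a = b then core_form n 2 z (mat 2 2 (\<lambda>(i, j). if i = j then a else 0))
    else core_form n 2 z (companion ([:- a, 1:] * [:- b, 1:]))"
proof -
  have blocks: "companion_blocks [([:- c, 1:], 1), ([:- d, 1:], 1)] \<in> carrier_mat 2 2" for c d :: 'a
    by (rule carrier_matI) (auto simp: companion_blocks_Cons companion_linear)
  obtain bs m where
    "mset bs = parts_pairs (punion (single {#1#} [:- a, 1:]) (single {#1#} [:- b, 1:]))" and
    core: "core_form n m z (companion_blocks bs)"
    using has_mtype_core_form[OF assms] by blast
  then have bs: "mset bs = {#([:- a, 1:], 1), ([:- b, 1:], 1)#}"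
    by (simp add: parts_pairs_punion_single add_mset_commute)
  have m: "m = 2" using mset_eq_pairE[OF bs] core_form_carrier(2)[OF core] blocks
    by (metis carrier_matD(1))
  show ?thesis
  proof (cases "a = b")
    case True
    with bs have "bs = [([:- a, 1:], 1), ([:- a, 1:], 1)]" by (auto elim!: mset_eq_pairE)
    moreover have "companion_blocks [([:- a, 1:], 1), ([:- a, 1:], 1)] =
        mat 2 2 (\<lambda>(i, j). if i = j then a else 0)"
      by (rule eq_matI) (auto simp: companion_blocks_Cons companion_linear less_Suc_eq numeral_2_eq_2)
    ultimately show ?thesis using core m True by simp
  next
    case False
    have "similar_mat (companion_blocks bs) (companion ([:- a, 1:] * [:- b, 1:]))"
      using bs
    proof (cases rule: mset_eq_pairE)
      case 1
      then show ?thesis using diagonal_similar_companion[OF False] by simp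
    next
      case 2
      then show ?thesis
        using diagonal_similar_companion[of b a] False mult.commute[of "[:- b, 1:]" "[:- a, 1:]"] by metis
    qed
    from core_form_similar_core[OF this core] show ?thesis using m False by simp
  qed
qed

lemma core_form_single_block:
  assumes "z \<in> carrier_mat n n" "has_mtype z (single {#k#} f)" "degree (f ^ k) = m"
  shows "core_form n m z (companion (f ^ k))"
proof -
  obtain bs m' where bs: "mset bs = {#(f, k)#}" and core: "core_form n m' z (companion_blocks bs)"
    using has_mtype_core_form[OF assms(1,2)] by (auto simp: parts_pairs_single)
  from bs have "bs = [(f, k)]" by simp
  with core have "core_form n m' z (companion (f ^ k))" by (simp add: companion_blocks_singleton)
  moreover from core_form_carrier(2)[OF this] have "m' = m"
    using companion_carrier[of "f ^ k"] assms(3) by (metis carrier_matD(1))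
  ultimately show ?thesis by simp
qed

lemma coeff_prod_two_linear:
  fixes a b xi eta :: "'a :: {finite, field}"
  assumes z: "z \<in> carrier_mat n n" and nz: "xi \<noteq> 0" "eta \<noteq> 0" and det: "det z = xi * eta"
    and ty: "has_mtype z (punion (single {#1#} [:- a, 1:]) (single {#1#} [:- b, 1:]))"
  shows "coeff_prod (single {#1#} [:- xi, 1:]) (single {#1#} [:- eta, 1:]) n z =
     (if a \<noteq> b \<and> {a, b} \<noteq> {xi, eta} then card (UNIV :: 'a set) - 1
      else if a \<noteq> b \<and> {a, b} = {xi, eta} then 2 * card (UNIV :: 'a set) - 1
      else if a = b \<and> b = xi \<and> xi = eta then card (UNIV :: 'a set) ^ 2 + card (UNIV :: 'a set)
      else 0)"
proof (cases "a = b")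
  case True
  let ?T = "mat 2 2 (\<lambda>(i, j). if i = j then a else 0)"
  from core_form_two_linear[OF z ty] True have core: "core_form n 2 z ?T" by simp
  have "xi * eta = a * a" using core_form_det[OF core] det by (simp add: det_mat_2)
  \<comment> \<open>Since xi eta = a^2, the equality \<open>a = xi\<close> already forces
    \<open>eta = xi\<close>.\<close>
  with nz have "a = xi \<longleftrightarrow> a = xi \<and> xi = eta" by auto
  then show ?thesis
    using coeff_prod_eq_card_splittings[OF core det nz] True by (auto simp: card_splittings_scalar)
next
  case False
  let ?p = "[:- a, 1:] * [:- b, 1:]"
  from core_form_two_linear[OF z ty] False have core: "core_form n 2 z (companion ?p)" by simp
  have "det (companion ?p) = a * b" by (subst det_mat_2) (auto simp: companion_def)
  then have ab: "a * b = xi * eta" using core_form_det[OF core] det by simp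
  have poly_p: "poly ?p k = (k - a) * (k - b)" for k by (simp add: algebra_simps)
  \<comment> \<open>Since a b = xi eta, as soon as \<open>xi\<close> is one of \<open>a\<close>,
    \<open>b\<close>, the other one is \<open>eta\<close>.\<close>
  with ab nz have iff: "{a, b} = {xi, eta} \<longleftrightarrow> poly ?p xi = 0"
    by (auto simp: doubleton_eq_iff)
  have "{k. poly ?p k = 0} = {a, b}" unfolding poly_p by auto
  then have "card {k. poly ?p k = 0} = 2" using False by simp
  moreover have "lead_coeff ?p = 1" "degree ?p = 2" by simp_all
  ultimately show ?thesis
    using coeff_prod_companion[OF core _ _ det nz] False iff by auto
qed

lemma coeff_prod_jordan_block:
  fixes a xi eta :: "'a :: {finite, field}"
  assumes z: "z \<in> carrier_mat n n" and nz: "xi \<noteq> 0" "eta \<noteq> 0" and det: "det z = xi * eta"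
    and ty: "has_mtype z (single {#2#} [:- a, 1:])"
  shows "coeff_prod (single {#1#} [:- xi, 1:]) (single {#1#} [:- eta, 1:]) n z =
    (if a \<notin> {xi, eta} then card (UNIV :: 'a set) else 2 * card (UNIV :: 'a set))"
proof -
  let ?p = "[:- a, 1:] ^ 2"
  have deg: "degree ?p = 2" by (simp add: degree_power_eq)
  have core: "core_form n 2 z (companion ?p)" by (rule core_form_single_block[OF z ty deg])
  have "det (companion ?p) = a * a"
    by (subst det_mat_2) (auto simp: companion_def power2_eq_square)
  then have "a * a = xi * eta" using core_form_det[OF core] det by simp
  \<comment> \<open>From a^2 = xi eta, \<open>a\<close> equals \<open>xi\<close> if and only if it
    equals \<open>eta\<close>, so testing \<open>xi\<close> suffices. The double root counts once,
    leaving q + 1 - 1 or 2 q + 1 - 1.\<close>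
  then have iff: "a \<in> {xi, eta} \<longleftrightarrow> poly ?p xi = 0" using nz by auto
  have "{k. poly ?p k = 0} = {a}" by auto
  then have "card {k. poly ?p k = 0} = 1" by simp
  moreover have "lead_coeff ?p = 1" by (simp add: lead_coeff_power)
  ultimately show ?thesis
    using coeff_prod_companion[OF core _ deg det nz] iff by auto
qed

lemma coeff_prod_irreducible:
  fixes xi eta :: "'a :: {finite, field}"
  assumes z: "z \<in> carrier_mat n n" and nz: "xi \<noteq> 0" "eta \<noteq> 0" and det: "det z = xi * eta"
    and f: "f \<in> Phi" "degree f = 2" and ty: "has_mtype z (single {#1#} f)"
  shows "coeff_prod (single {#1#} [:- xi, 1:]) (single {#1#} [:- eta, 1:]) n z = card (UNIV :: 'a set) + 1"
proof -
  have core: "core_form n 2 z (companion f)" using core_form_single_block[OF z ty] f(2) by simp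
  \<comment> \<open>A root would make \<open>f\<close> linear, so no slope is lost; in particular
    \<open>xi\<close> is not a root and the conic is nondegenerate.\<close>
  have noroot: "poly f k \<noteq> 0" for k using Phi_root[OF f(1), of k] f(2) by auto
  have "lead_coeff f = 1" using f(1) by (simp add: Phi_def)
  from coeff_prod_companion[OF core this f(2) det nz] noroot show ?thesis by simp
qed

theorem theorem4p4:
  fixes xi eta xi' eta' :: "'a :: {finite, field}" and f :: "'a poly"
  defines "q \<equiv> card (UNIV :: 'a set)"
  defines "lam \<equiv> single {#1#} [:- xi, 1:]"
  defines "mu \<equiv> single {#1#} [:- eta, 1:]"
  assumes "xi \<noteq> 0" and "eta \<noteq> 0" and "xi' \<noteq> 0" and "eta' \<noteq> 0"
    and "f \<in> Phi" and "degree f = 2"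
  shows
    "(\<forall>nu \<in> PPhi. pnorm nu = 2 \<longrightarrow>
       (\<forall>n z. n \<ge> pnorm nu + size (epart nu) \<longrightarrow> z \<in> GL n \<longrightarrow> has_mtype z nu
          \<longrightarrow> det z \<noteq> xi * eta \<longrightarrow> coeff_prod lam mu n z = 0)) \<and>
    (\<forall>n z. let nu = punion (single {#1#} [:- xi', 1:]) (single {#1#} [:- eta', 1:]) in
       n \<ge> pnorm nu + size (epart nu) \<longrightarrow> z \<in> GL n \<longrightarrow> has_mtype z nu
          \<longrightarrow> det z = xi * eta \<longrightarrow>
       coeff_prod lam mu n z =
         (if xi' \<noteq> eta' \<and> {xi', eta'} \<noteq> {xi, eta} then q - 1
          else if xi' \<noteq> eta' \<and> {xi', eta'} = {xi, eta} then 2 * q - 1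
          else if xi' = eta' \<and> eta' = xi \<and> xi = eta then q ^ 2 + q
          else 0)) \<and>
    (\<forall>n z. let nu = single {#2#} [:- xi', 1:] in
       n \<ge> pnorm nu + size (epart nu) \<longrightarrow> z \<in> GL n \<longrightarrow> has_mtype z nu
          \<longrightarrow> det z = xi * eta \<longrightarrow>
       coeff_prod lam mu n z = (if xi' \<notin> {xi, eta} then q else 2 * q)) \<and>
    (\<forall>n z. let nu = single {#1#} f in
       n \<ge> pnorm nu + size (epart nu) \<longrightarrow> z \<in> GL n \<longrightarrow> has_mtype z nu
          \<longrightarrow> det z = xi * eta \<longrightarrow>
       coeff_prod lam mu n z = q + 1)"
proof (intro conjI ballI allI impI; (unfold Let_def)?; (intro impI)?)
  note defs = q_def lam_def mu_def
  fix n and z :: "'a mat"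
  assume z: "z \<in> GL n"
  then have zc: "z \<in> carrier_mat n n" by (simp add: GL_def)
  show "coeff_prod lam mu n z = 0" if "det z \<noteq> xi * eta"
    unfolding defs using coeff_prod_eq_0[OF zc that assms(4,5)] .
  show "coeff_prod lam mu n z =
         (if xi' \<noteq> eta' \<and> {xi', eta'} \<noteq> {xi, eta} then q - 1
          else if xi' \<noteq> eta' \<and> {xi', eta'} = {xi, eta} then 2 * q - 1
          else if xi' = eta' \<and> eta' = xi \<and> xi = eta then q ^ 2 + q
          else 0)"
    if "has_mtype z (punion (single {#1#} [:- xi', 1:]) (single {#1#} [:- eta', 1:]))" "det z = xi * eta"
    unfolding defs by (rule coeff_prod_two_linear[OF zc assms(4,5) that(2,1)])
  show "coeff_prod lam mu n z = (if xi' \<notin> {xi, eta} then q else 2 * q)"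
    if "has_mtype z (single {#2#} [:- xi', 1:])" "det z = xi * eta"
    unfolding defs by (rule coeff_prod_jordan_block[OF zc assms(4,5) that(2,1)])
  show "coeff_prod lam mu n z = q + 1" if "has_mtype z (single {#1#} f)" "det z = xi * eta"
    unfolding defs by (rule coeff_prod_irreducible[OF zc assms(4,5) that(2) assms(8,9) that(1)])
qed

end
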